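(* For $k\ge1$ consider the permutations $$w_k^-=(2,4,\dots,2k,2k-1,2k-3,\dots,3,1)\in\mathbb{S}_{2k},\qquad w_k^+=(2,4,\dots,2k,2k+1,2k-1,\dots,3,1)\in\mathbb{S}_{2k+1}$$ (in one-line notation). Then $$\mathfrak{S}_{w_k^-}(1)=\mathrm{CSTCPP}(k),\qquad\mathfrak{S}_{w_k^+}(1)=\mathrm{VSASM}(k),$$ where $\mathfrak{S}_w(1)$ denotes the value of the Schubert polynomial $\mathfrak{S}_w$ at $x_1=x_2=\cdots=1$.
   Context: $\mathrm{VSASM}(n)$ is the number of alternating sign $(2n+1)\times(2n+1)$ matrices symmetric about the vertical axis, $$\mathrm{VSASM}(n)=\prod_{j=1}^{n-1}\frac{(3j+2)(6j+3)!\,(2j+1)!}{(4j+2)!\,(4j+3)!},$$ and $\mathrm{CSTCPP}(n)$ is the number of cyclically symmetric transpose complement plane partitions, given by $$\mathrm{CSTCPP}(n)=\prod_{j=1}^{n-1}\frac{(3j+1)(6j)!\,(2j)!}{(4j+1)!\,(4j)!}.$$ Schubert polynomials are the standard ones of Lascoux–Schützenberger ($\mathfrak{S}_{w_0}=x_1^{n-1}x_2^{n-2}\cdots x_{n-1}$ for the longest $w_0\in\mathbb{S}_n$, and $\mathfrak{S}_{ws_i}=\partial_i\mathfrak{S}_w$ if $\ell(ws_i)=\ell(w)-1$). *)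

theory Defs
  imports Complex_Main "HOL-Library.Poly_Mapping" "HOL-Combinatorics.Permutations"
begin

section \<open>Integer polynomials in the variables x_1, x_2, ...\<close>

text \<open>A polynomial maps exponent vectors (of finite support) to coefficients. All permutations
  below move only positive integers, so the variable of index 0 never occurs.\<close>

type_synonym zpoly = "(nat \<Rightarrow>\<^sub>0 nat) \<Rightarrow>\<^sub>0 int"

definition X :: "nat \<Rightarrow> zpoly" where
  "X i = Poly_Mapping.single (Poly_Mapping.single i 1) 1"

definition subst :: "(nat \<Rightarrow> 'r) \<Rightarrow> zpoly \<Rightarrow> 'r::comm_ring_1" where
  "subst a f = (\<Sum>m \<in> Poly_Mapping.keys f. of_int (Poly_Mapping.lookup f m) *
     (\<Prod>i \<in> Poly_Mapping.keys m. a i ^ Poly_Mapping.lookup m i))"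

text \<open>The divided difference (f - s_i f) / (x_i - x_{i+1}), where s_i exchanges x_i and x_{i+1};
  the quotient is unique since polynomials form an integral domain.\<close>

definition divided_diff :: "nat \<Rightarrow> zpoly \<Rightarrow> zpoly" where
  "divided_diff i f =
     (THE g. (X i - X (Suc i)) * g = f - subst (\<lambda>j. X (transpose i (Suc i) j)) f)"

section \<open>Permutations and Schubert polynomials\<close>

text \<open>The permutation of {1..n} given by a word of length n in one-line notation, extended by the
  identity. List positions are counted from 0, points from 1.\<close>

definition one_line :: "nat list \<Rightarrow> nat \<Rightarrow> nat" where
  "one_line xs i = (if i \<in> {1..length xs} then xs ! (i - 1) else i)"

definition perm_length :: "nat \<Rightarrow> (nat \<Rightarrow> nat) \<Rightarrow> nat" where
  "perm_length n w = card {(i, j). i \<in> {1..n} \<and> j \<in> {1..n} \<and> i < j \<and> w j < w i}"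

definition longest_perm :: "nat \<Rightarrow> nat \<Rightarrow> nat" where
  "longest_perm n = one_line (rev [1..<Suc n])"

inductive schubert_rel :: "nat \<Rightarrow> (nat \<Rightarrow> nat) \<Rightarrow> zpoly \<Rightarrow> bool" for n where
  longest: "schubert_rel n (longest_perm n) (\<Prod>i=1..<n. X i ^ (n - i))"
| descend: "schubert_rel n w f \<Longrightarrow> i \<in> {1..<n} \<Longrightarrow>
    perm_length n w = perm_length n (w \<circ> transpose i (Suc i)) + 1 \<Longrightarrow>
    schubert_rel n (w \<circ> transpose i (Suc i)) (divided_diff i f)"

text \<open>That the result does not depend on the chain of descents from the longest element is the
  classical theorem of Lascoux and Schuetzenberger.\<close>

definition schubert :: "nat \<Rightarrow> (nat \<Rightarrow> nat) \<Rightarrow> zpoly" where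
  "schubert n w = (THE f. schubert_rel n w f)"

section \<open>The permutations and the enumeration numbers\<close>

definition w_minus :: "nat \<Rightarrow> nat \<Rightarrow> nat" where
  "w_minus k = one_line (map (\<lambda>i. 2 * i) [1..<Suc k] @ rev (map (\<lambda>i. 2 * i + 1) [0..<k]))"

definition w_plus :: "nat \<Rightarrow> nat \<Rightarrow> nat" where
  "w_plus k = one_line (map (\<lambda>i. 2 * i) [1..<Suc k] @ rev (map (\<lambda>i. 2 * i + 1) [0..<Suc k]))"

text \<open>The product formulas for the number of vertically symmetric alternating sign matrices of
  order 2n+1 and the number of cyclically symmetric transpose complement plane partitions
  (in the box of side 2n). The quotients need not be integers factor by factor, hence the
  rational values.\<close>

definition VSASM :: "nat \<Rightarrow> rat" where
  "VSASM n = (\<Prod>j=1..<n. (of_nat (3*j + 2) * fact (6*j + 3) * fact (2*j + 1)) /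
                          (fact (4*j + 2) * fact (4*j + 3)))"

definition CSTCPP :: "nat \<Rightarrow> rat" where
  "CSTCPP n = (\<Prod>j=1..<n. (of_nat (3*j + 1) * fact (6*j) * fact (2*j)) /
                           (fact (4*j + 1) * fact (4*j)))"

end

theory Submission
  imports Defs "HOL-Computational_Algebra.Formal_Power_Series" "Jordan_Normal_Form.Determinant"
begin

text \<open>
  The longest element of \<open>S_n\<close> has the flagged Jacobi-Trudi determinant with row \<open>i\<close> in the variables
  \<open>x_1, ..., x_i\<close>. A divided difference \<open>\<partial>_p\<close> acts on such a determinant through a single row, provided
  that only this row has flag \<open>p\<close>, and then merely raises this flag to \<open>p + 1\<close>; inserting
  \<open>1, 2, ..., n\<close> one after the other into the middle of a word, one reaches the given permutations
  in this way. At \<open>x_i = 1\<close> the determinant has binomial entries, and up to unitriangular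
  column operations its rows are the coefficient vectors of \<open>x^\<lceil>i/2\<rceil> (1 + x)^i\<close> for \<open>i < n\<close>, that is
  of \<open>t^m\<close> and \<open>x (1 + x) t^m\<close> with \<open>t = x (1 + x)\<^sup>2\<close>.

  Gaussian elimination of these rows is a continued fraction expansion of \<open>x (1 + x)\<close> in powers
  of \<open>t\<close>: the reduced rows satisfy \<open>R_(n+2) = t R_n - (p_n / p_(n+1)) R_(n+1)\<close>, where \<open>p_n\<close> is the
  pivot, the coefficient of \<open>x^n\<close> in \<open>R_n\<close>. The pivots are found from a first-order differential system
  satisfied by the pairs \<open>R_n, R_(n+1)\<close>, and the determinant is \<open>p_0 p_1 ... p_(n-1)\<close>.
\<close>

section \<open>Substitution and divided differences\<close>

definition monomial_value :: "(nat \<Rightarrow> 'r) \<Rightarrow> (nat \<Rightarrow>\<^sub>0 nat) \<Rightarrow> 'r::comm_ring_1" where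
  "monomial_value a m = (\<Prod>i \<in> Poly_Mapping.keys m. a i ^ Poly_Mapping.lookup m i)"

lemma monomial_value_superset:
  assumes "finite S" "Poly_Mapping.keys m \<subseteq> S"
  shows "monomial_value a m = (\<Prod>i\<in>S. a i ^ Poly_Mapping.lookup m i)"
  unfolding monomial_value_def
  by (rule prod.mono_neutral_left) (use assms in \<open>auto simp: in_keys_iff\<close>)

lemma monomial_value_add: "monomial_value a (m + m') = monomial_value a m * monomial_value a m'"
proof -
  let ?S = "Poly_Mapping.keys m \<union> Poly_Mapping.keys m'"
  have "Poly_Mapping.keys (m + m') \<subseteq> ?S" by (rule keys_add)
  then have "monomial_value a (m + m') = (\<Prod>i\<in>?S. a i ^ Poly_Mapping.lookup (m + m') i)"
    by (intro monomial_value_superset) auto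
  moreover have "monomial_value a m = (\<Prod>i\<in>?S. a i ^ Poly_Mapping.lookup m i)"
    "monomial_value a m' = (\<Prod>i\<in>?S. a i ^ Poly_Mapping.lookup m' i)"
    by (intro monomial_value_superset; auto)+
  ultimately show ?thesis by (simp add: lookup_add power_add prod.distrib)
qed

lemma monomial_value_zero: "monomial_value a 0 = 1"
  by (simp add: monomial_value_def)

lemma subst_superset:
  assumes "finite S" "Poly_Mapping.keys f \<subseteq> S"
  shows "subst a f = (\<Sum>m\<in>S. of_int (Poly_Mapping.lookup f m) * monomial_value a m)"
  unfolding subst_def monomial_value_def
  by (rule sum.mono_neutral_left) (use assms in \<open>auto simp: in_keys_iff\<close>)

lemma subst_add: "subst a (f + g) = subst a f + subst a g"
proof -
  let ?S = "Poly_Mapping.keys f \<union> Poly_Mapping.keys g"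
  have "Poly_Mapping.keys (f + g) \<subseteq> ?S" by (rule keys_add)
  then show ?thesis
    by (simp add: subst_superset[of ?S] lookup_add algebra_simps sum.distrib)
qed

lemma subst_single: "subst a (Poly_Mapping.single m c) = of_int c * monomial_value a m"
  by (subst subst_superset[of "{m}"]) auto

lemma subst_zero: "subst a 0 = 0"
  by (simp add: subst_def)

lemma subst_sum: "subst a (sum f S) = (\<Sum>i\<in>S. subst a (f i))"
  by (induction S rule: infinite_finite_induct) (simp_all add: subst_zero subst_add)

lemma zpoly_sum_single:
  "(f :: zpoly) = (\<Sum>m\<in>Poly_Mapping.keys f. Poly_Mapping.single m (Poly_Mapping.lookup f m))"
  by (rule poly_mapping_eqI) (auto simp: lookup_sum lookup_single when_def in_keys_iff)

lemma subst_mult: "subst a (f * g) = subst a f * subst a g"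
proof -
  have "f * g = (\<Sum>m\<in>Poly_Mapping.keys f. \<Sum>m'\<in>Poly_Mapping.keys g.
     Poly_Mapping.single (m + m') (Poly_Mapping.lookup f m * Poly_Mapping.lookup g m'))"
    by (subst (1) zpoly_sum_single[of f], subst (1) zpoly_sum_single[of g])
      (simp add: sum_product mult_single)
  then have "subst a (f * g) = (\<Sum>m\<in>Poly_Mapping.keys f. \<Sum>m'\<in>Poly_Mapping.keys g.
     (of_int (Poly_Mapping.lookup f m) * monomial_value a m) *
     (of_int (Poly_Mapping.lookup g m') * monomial_value a m'))"
    by (simp add: subst_sum subst_single monomial_value_add mult_ac)
  also have "\<dots> = subst a f * subst a g"
    by (simp add: subst_def monomial_value_def sum_product)
  finally show ?thesis .
qed

lemma subst_one: "subst a 1 = 1"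
  using subst_single[of a 0 1] by (simp add: monomial_value_zero)

lemma subst_X: "subst a (X i) = a i"
  by (simp add: X_def subst_single monomial_value_def)

lemma subst_uminus: "subst a (- f) = - subst a f"
  using subst_add[of a f "- f"] by (simp add: subst_zero add_eq_0_iff2 minus_equation_iff)

lemma subst_diff: "subst a (f - g) = subst a f - subst a g"
  using subst_add[of a f "- g"] by (simp add: subst_uminus)

lemma subst_power: "subst a (f ^ n) = subst a f ^ n"
  by (induction n) (simp_all add: subst_one subst_mult)

lemma subst_prod: "subst a (prod f S) = (\<Prod>i\<in>S. subst a (f i))"
  by (induction S rule: infinite_finite_induct) (simp_all add: subst_one subst_mult)

lemma of_int_zpoly: "(of_int c :: zpoly) = Poly_Mapping.single 0 c"
  by (subst single_of_int[symmetric]) simp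

lemma subst_of_int: "subst a (of_int c) = of_int c"
  by (simp only: of_int_zpoly subst_single monomial_value_zero mult_1_right)

lemmas subst_hom = subst_add subst_diff subst_uminus subst_mult subst_one subst_zero subst_X
  subst_power subst_sum subst_prod subst_of_int

lemma subst_subst: "subst b (subst a f) = subst (\<lambda>i. subst b (a i)) f"
proof -
  have "subst b (subst a f) = subst b (\<Sum>m \<in> Poly_Mapping.keys f. of_int (Poly_Mapping.lookup f m) *
      (\<Prod>i \<in> Poly_Mapping.keys m. a i ^ Poly_Mapping.lookup m i))"
    by (simp only: subst_def[of a])
  also have "\<dots> = subst (\<lambda>i. subst b (a i)) f"
    by (simp only: subst_hom subst_def[of "\<lambda>i. subst b (a i)"])
  finally show ?thesis .
qed

text \<open>Presents a polynomial as an expression in constants and variables, so that a property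
  stable under sums and products has to be checked on these only.\<close>

lemma subst_X_id: "subst X f = f"
proof -
  have power: "X i ^ e = Poly_Mapping.single (Poly_Mapping.single i e) 1" for i e
    by (induction e) (simp_all add: X_def mult_single flip: single_add)
  have prod: "(\<Prod>i\<in>S. Poly_Mapping.single (h i) 1 :: zpoly) = Poly_Mapping.single (sum h S) 1"
    for S :: "nat set" and h
    by (induction S rule: infinite_finite_induct) (simp_all add: mult_single)
  have "monomial_value X m = Poly_Mapping.single m 1" for m
  proof -
    have "m = (\<Sum>i\<in>Poly_Mapping.keys m. Poly_Mapping.single i (Poly_Mapping.lookup m i))"
      by (rule poly_mapping_eqI) (auto simp: lookup_sum lookup_single when_def in_keys_iff)
    then show ?thesis by (simp add: monomial_value_def power prod)
  qed
  then have "subst X f = (\<Sum>m\<in>Poly_Mapping.keys f. of_int (Poly_Mapping.lookup f m) * Poly_Mapping.single m 1)"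
    by (simp add: subst_def monomial_value_def)
  also have "\<dots> = (\<Sum>m\<in>Poly_Mapping.keys f. Poly_Mapping.single m (Poly_Mapping.lookup f m))"
  proof (rule sum.cong)
    fix m
    show "(of_int (Poly_Mapping.lookup f m) * Poly_Mapping.single m 1 :: zpoly) =
        Poly_Mapping.single m (Poly_Mapping.lookup f m)"
      by (simp only: of_int_zpoly mult_single) simp
  qed simp
  finally show ?thesis using zpoly_sum_single by simp
qed

section \<open>Divided differences and their commutation and braid relations\<close>

abbreviation swap :: "nat \<Rightarrow> zpoly \<Rightarrow> zpoly" where
  "swap i \<equiv> subst (\<lambda>j. X (transpose i (Suc i) j))"

lemma X_inject: "X i = X j \<longleftrightarrow> i = j"
proof
  assume "X i = X j"
  then have "Poly_Mapping.single i 1 = Poly_Mapping.single j (1 :: nat)"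
    unfolding X_def by (metis keys_single one_neq_zero singleton_inject)
  then show "i = j" by (metis keys_single one_neq_zero singleton_inject)
qed simp

lemma X_diff_nonzero: "i \<noteq> j \<Longrightarrow> X i - X j \<noteq> 0"
  by (simp add: X_inject)

text \<open>Polynomials form an integral domain, so the denominator can be cancelled and the
  description by \<open>THE\<close> has at most one solution.\<close>

lemma divided_diff_eqI:
  assumes "(X i - X (Suc i)) * g = f - swap i f"
  shows "divided_diff i f = g"
  unfolding divided_diff_def
proof (rule the_equality)
  fix h assume "(X i - X (Suc i)) * h = f - swap i f"
  then have "(X i - X (Suc i)) * h = (X i - X (Suc i)) * g" using assms by simp
  then show "h = g" using X_diff_nonzero[of i "Suc i"] mult_left_cancel by fastforce
qed (rule assms)

text \<open>By the twisted Leibniz rule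
  \<open>g * h - s (g * h) = (g - s g) * h + s g * (h - s h)\<close>, the polynomials with this
  property are closed under products as well as sums, and they contain the constants and the
  variables. This makes the divided difference exist.\<close>

lemma dvd_diff_swap: "X i - X (Suc i) dvd f - swap i f"
proof -
  define D where "D = {g. X i - X (Suc i) dvd g - swap i g}"
  have add: "g + h \<in> D" if "g \<in> D" "h \<in> D" for g h
  proof -
    have "g + h - swap i (g + h) = (g - swap i g) + (h - swap i h)" by (simp add: subst_hom)
    moreover have "X i - X (Suc i) dvd (g - swap i g) + (h - swap i h)"
      by (intro dvd_add) (use that in \<open>simp_all only: D_def mem_Collect_eq\<close>)
    ultimately show ?thesis by (simp only: D_def mem_Collect_eq)
  qed
  have mult: "g * h \<in> D" if "g \<in> D" "h \<in> D" for g h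
  proof -
    have "g * h - swap i (g * h) = (g - swap i g) * h + swap i g * (h - swap i h)"
      by (simp add: subst_hom algebra_simps)
    moreover have "X i - X (Suc i) dvd (g - swap i g) * h + swap i g * (h - swap i h)"
      by (intro dvd_add dvd_mult dvd_mult2) (use that in \<open>simp_all only: D_def mem_Collect_eq\<close>)
    ultimately show ?thesis by (simp only: D_def mem_Collect_eq)
  qed
  have const: "of_int c \<in> D" for c by (simp add: D_def subst_hom)
  have X: "X j \<in> D" for j
  proof -
    have "X (Suc i) - X i = - (X i - X (Suc i))" by simp
    then have "X i - X (Suc i) dvd X (Suc i) - X i" by (simp only: dvd_minus_iff dvd_refl)
    then show ?thesis by (auto simp: D_def subst_hom transpose_def)
  qed
  have one: "1 \<in> D" using const[of 1] by simp
  have zero: "0 \<in> D" using const[of 0] by simp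
  have power: "X j ^ e \<in> D" for j e by (induction e) (auto intro: one mult X)
  have prod: "(\<And>j. j \<in> S \<Longrightarrow> h j \<in> D) \<Longrightarrow> prod h S \<in> D" for S :: "nat set" and h
    by (induction S rule: infinite_finite_induct) (auto intro: one mult)
  have sum: "(\<And>j. j \<in> S \<Longrightarrow> h j \<in> D) \<Longrightarrow> sum h S \<in> D" for S :: "(nat \<Rightarrow>\<^sub>0 nat) set" and h
    by (induction S rule: infinite_finite_induct) (auto intro: zero add)
  have "subst X f \<in> D" unfolding subst_def
    by (intro sum mult const prod power)
  then show ?thesis by (simp add: D_def subst_X_id)
qed

lemma divided_diff: "(X i - X (Suc i)) * divided_diff i f = f - swap i f"
proof -
  obtain g where "f - swap i f = (X i - X (Suc i)) * g"
    using dvd_diff_swap[of i f] by (auto elim: dvdE)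
  then show ?thesis using divided_diff_eqI[of i g f] by simp
qed

lemma swap_swap: "swap i (swap i f) = f"
  by (simp add: subst_subst subst_X subst_X_id)

text \<open>Numerator and denominator of the quotient both change sign under
  \<open>swap i\<close>.\<close>

lemma swap_divided_diff: "swap i (divided_diff i f) = divided_diff i f"
proof -
  have "(X (Suc i) - X i) * swap i (divided_diff i f) = swap i f - f"
    using arg_cong[OF divided_diff[of i f], of "swap i"] by (simp add: subst_hom swap_swap)
  then have "(X i - X (Suc i)) * swap i (divided_diff i f) = f - swap i f"
    by (simp add: algebra_simps)
  then show ?thesis by (rule divided_diff_eqI[symmetric])
qed

text \<open>Multiplied by both denominators, either side becomes the alternating sum of
  \<open>f\<close> over the four-element group generated by the two swaps; each swap fixes the
  denominator of the other.\<close>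

lemma divided_diff_commute:
  assumes "Suc i < j"
  shows "divided_diff i (divided_diff j f) = divided_diff j (divided_diff i f)"
proof -
  have double_quotient: "a * b * r = c - e - d + d'"
    if "a * r = q - q'" "b * q = c - e" "b * q' = d - d'" for a b c d e d' q q' r :: zpoly
  proof -
    have "a * b * r = b * (a * r)" by (simp add: mult_ac)
    also have "\<dots> = b * q - b * q'" by (simp only: that(1) right_diff_distrib)
    finally show ?thesis by (simp add: that)
  qed
  have comm: "swap i (swap j f) = swap j (swap i f)"
    using assms by (auto simp: subst_subst subst_X transpose_def intro!: arg_cong[of _ _ "\<lambda>a. subst a f"])
  have "(X j - X (Suc j)) * swap i (divided_diff j f) = swap i f - swap i (swap j f)"
    using arg_cong[OF divided_diff[of j f], of "swap i"] assms by (simp add: subst_hom transpose_def)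
  then have 1: "(X i - X (Suc i)) * (X j - X (Suc j)) * divided_diff i (divided_diff j f) =
      f - swap j f - swap i f + swap i (swap j f)"
    by (rule double_quotient[OF divided_diff[of i "divided_diff j f"] divided_diff[of j f]])
  have "(X i - X (Suc i)) * swap j (divided_diff i f) = swap j f - swap j (swap i f)"
    using arg_cong[OF divided_diff[of i f], of "swap j"] assms by (simp add: subst_hom transpose_def)
  then have "(X j - X (Suc j)) * (X i - X (Suc i)) * divided_diff j (divided_diff i f) =
      f - swap i f - swap j f + swap j (swap i f)"
    by (rule double_quotient[OF divided_diff[of j "divided_diff i f"] divided_diff[of i f]])
  then have 2: "(X i - X (Suc i)) * (X j - X (Suc j)) * divided_diff j (divided_diff i f) =
      f - swap j f - swap i f + swap i (swap j f)"
    unfolding comm by (simp add: mult.commute algebra_simps)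
  have "(X i - X (Suc i)) * (X j - X (Suc j)) \<noteq> 0" by (simp add: X_inject)
  then show ?thesis using 1 2 mult_left_cancel by metis
qed

text \<open>Multiplied by the Vandermonde product \<open>(x - y) * (y - z) * (x - z)\<close>, either
  side becomes \<open>W\<close>, the alternating sum of \<open>f\<close> over the permutations of
  three variables.\<close>

lemma divided_diff_braid:
  "divided_diff i (divided_diff (Suc i) (divided_diff i f)) =
   divided_diff (Suc i) (divided_diff i (divided_diff (Suc i) f))"
proof -
  define x y z s t where "x = X i" and "y = X (Suc i)" and "z = X (Suc (Suc i))"
    and "s = swap i" and "t = swap (Suc i)"
  have sx: "s x = y" "s y = x" "s z = z" "t x = x" "t y = z" "t z = y"
    by (simp_all add: s_def t_def x_def y_def z_def subst_X transpose_def)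
  have hom: "s (p - q) = s p - s q" "s (p * q) = s p * s q"
    "t (p - q) = t p - t q" "t (p * q) = t p * t q" for p q
    by (simp_all add: s_def t_def subst_hom)
  have braid: "s (t (s f)) = t (s (t f))"
    by (auto simp: s_def t_def subst_subst subst_X transpose_def intro!: arg_cong[of _ _ "\<lambda>a. subst a f"])
  define g h k where "g = divided_diff i f" and "h = divided_diff (Suc i) g" and "k = divided_diff i h"
  define g' h' k' where "g' = divided_diff (Suc i) f" and "h' = divided_diff i g'"
    and "k' = divided_diff (Suc i) h'"
  have dd: "(x - y) * g = f - s f" "(y - z) * h = g - t g" "(x - y) * k = h - s h"
    "(y - z) * g' = f - t f" "(x - y) * h' = g' - s g'" "(y - z) * k' = h' - t h'"
    by (simp_all add: g_def h_def k_def g'_def h'_def k'_def x_def y_def z_def s_def t_def divided_diff)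
  have inv: "s g = g" "t g' = g'"
    by (simp_all add: g_def g'_def s_def t_def swap_divided_diff)
  \<comment> \<open>The swap \<open>s\<close> turns the denominator \<open>y - z\<close> into
    \<open>x - z\<close>. The equations up to \<open>b3\<close> arise likewise, by applying
    \<open>s\<close> or \<open>t\<close> to an earlier one.\<close>
  have a1: "(x - z) * s h = g - s (t g)"
    using arg_cong[OF dd(2), of s] by (simp add: hom sx inv)
  have a2: "(x - z) * t g = t f - t (s f)"
    using arg_cong[OF dd(1), of t] by (simp add: hom sx)
  have a3: "(y - z) * s (t g) = s (t f) - s (t (s f))"
    using arg_cong[OF a2, of s] by (simp add: hom sx)
  have b1: "(x - z) * t h' = g' - t (s g')"
    using arg_cong[OF dd(5), of t] by (simp add: hom sx inv)
  have b2: "(x - z) * s g' = s f - s (t f)"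
    using arg_cong[OF dd(4), of s] by (simp add: hom sx)
  have b3: "(x - y) * t (s g') = t (s f) - t (s (t f))"
    using arg_cong[OF b2, of t] by (simp add: hom sx)
  define W where "W = f - s f - t f + t (s f) + s (t f) - s (t (s f))"
  have "(x - y) * (y - z) * (x - z) * k = W"
  proof -
    have "(x - y) * (y - z) * (x - z) * k = (y - z) * (x - z) * ((x - y) * k)"
      by (simp only: mult_ac)
    also have "\<dots> = (x - z) * ((y - z) * h) - (y - z) * ((x - z) * s h)"
      unfolding dd(3) by (simp add: algebra_simps)
    also have "\<dots> = (x - y) * g - (x - z) * t g + (y - z) * s (t g)"
      unfolding dd(2) a1 by (simp add: algebra_simps)
    finally show ?thesis unfolding dd a2 a3 W_def by simp
  qed
  moreover have "(x - y) * (y - z) * (x - z) * k' = W"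
  proof -
    have "(x - y) * (y - z) * (x - z) * k' = (x - y) * (x - z) * ((y - z) * k')"
      by (simp only: mult_ac)
    also have "\<dots> = (x - z) * ((x - y) * h') - (x - y) * ((x - z) * t h')"
      unfolding dd(6) by (simp add: algebra_simps)
    also have "\<dots> = (y - z) * g' - (x - z) * s g' + (x - y) * t (s g')"
      unfolding dd(5) b1 by (simp add: algebra_simps)
    finally show ?thesis unfolding dd b2 b3 W_def braid by simp
  qed
  moreover have "(x - y) * (y - z) * (x - z) \<noteq> 0"
    by (simp add: x_def y_def z_def X_inject)
  ultimately have "k = k'" using mult_left_cancel by metis
  then show ?thesis by (simp add: k_def h_def g_def k'_def h'_def g'_def)
qed

section \<open>Independence of the chain of descents\<close>

lemma transpose_Suc_in_interval:
  "i \<in> {1..<n} \<Longrightarrow> transpose i (Suc i) j \<in> {1..n} \<longleftrightarrow> j \<in> {1..n}"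
  by (auto simp: transpose_def)

lemma transpose_Suc_less:
  "a < b \<Longrightarrow> (a, b) \<noteq> (i, Suc i) \<Longrightarrow> transpose i (Suc i) a < transpose i (Suc i) b"
  by (auto simp: transpose_def)

text \<open>Moving both positions by the transposition carries inversions to inversions, since it
  reverses the order of no pair of positions but \<open>(i, Suc i)\<close>; that pair is the one new
  inversion.\<close>

lemma perm_length_ascent:
  assumes i: "i \<in> {1..<n}" and asc: "w i < w (Suc i)"
  shows "perm_length n (w \<circ> transpose i (Suc i)) = perm_length n w + 1"
proof -
  let ?\<tau> = "transpose i (Suc i)"
  define inversions where "inversions u = {(a, b). a \<in> {1..n} \<and> b \<in> {1..n} \<and> a < b \<and> u b < u a}" for u :: "nat \<Rightarrow> nat"
  have fin: "finite (inversions u)" for u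
    by (rule finite_subset[of _ "{1..n} \<times> {1..n}"]) (auto simp: inversions_def)
  have "inversions (w \<circ> ?\<tau>) = insert (i, Suc i) (map_prod ?\<tau> ?\<tau> ` inversions w)"
  proof (intro equalityI subsetI)
    fix p assume p: "p \<in> inversions (w \<circ> ?\<tau>)"
    obtain a b where ab: "p = (a, b)" by (cases p)
    show "p \<in> insert (i, Suc i) (map_prod ?\<tau> ?\<tau> ` inversions w)"
    proof (cases "(a, b) = (i, Suc i)")
      case False
      then have "(?\<tau> a, ?\<tau> b) \<in> inversions w"
        using p ab transpose_Suc_less[of a b i] transpose_Suc_in_interval[OF i]
        by (auto simp: inversions_def)
      then have "map_prod ?\<tau> ?\<tau> (?\<tau> a, ?\<tau> b) \<in> map_prod ?\<tau> ?\<tau> ` inversions w" by blast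
      then show ?thesis by (simp add: ab)
    qed (simp add: ab)
  next
    fix p assume "p \<in> insert (i, Suc i) (map_prod ?\<tau> ?\<tau> ` inversions w)"
    then consider "p = (i, Suc i)" | a b where "p = (?\<tau> a, ?\<tau> b)" "(a, b) \<in> inversions w" by auto
    then show "p \<in> inversions (w \<circ> ?\<tau>)"
    proof cases
      case 1
      then show ?thesis using i asc by (auto simp: inversions_def)
    next
      case 2
      moreover from 2 asc have "(a, b) \<noteq> (i, Suc i)" by (auto simp: inversions_def)
      ultimately show ?thesis
        using transpose_Suc_less[of a b i] transpose_Suc_in_interval[OF i]
        by (auto simp: inversions_def)
    qed
  qed
  moreover have "(i, Suc i) \<notin> map_prod ?\<tau> ?\<tau> ` inversions w"
  proof
    assume "(i, Suc i) \<in> map_prod ?\<tau> ?\<tau> ` inversions w"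
    then obtain a b where "(a, b) \<in> inversions w" "?\<tau> a = i" "?\<tau> b = Suc i" by auto
    then have "a = Suc i" "b = i" by (metis transpose_apply_first transpose_apply_second transpose_involutory)+
    with \<open>(a, b) \<in> inversions w\<close> show False by (simp add: inversions_def)
  qed
  moreover have "inj_on (map_prod ?\<tau> ?\<tau>) (inversions w)"
    by (rule inj_on_subset[of _ UNIV]) (auto intro: prod.inj_map)
  ultimately have "card (inversions (w \<circ> ?\<tau>)) = Suc (card (inversions w))"
    using fin by (simp add: card_image)
  then show ?thesis by (simp add: perm_length_def inversions_def)
qed

text \<open>Translates the length condition of \<open>descend\<close> into a comparison of
  neighbouring values. A descent of \<open>w\<close> is an ascent after composing with the
  transposition, so \<open>perm_length_ascent\<close> covers both cases.\<close>

lemma perm_length_descent_iff: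
  assumes "i \<in> {1..<n}" and "w permutes {1..n}"
  shows "perm_length n w = perm_length n (w \<circ> transpose i (Suc i)) + 1 \<longleftrightarrow> w (Suc i) < w i"
proof -
  have "w i \<noteq> w (Suc i)" using permutes_inj[OF assms(2)] by (metis injD n_not_Suc_n)
  then consider "w i < w (Suc i)" | "w (Suc i) < w i" by linarith
  then show ?thesis
  proof cases
    case 1
    then show ?thesis using perm_length_ascent[OF assms(1), of w] by simp
  next
    case 2
    then show ?thesis
      using perm_length_ascent[OF assms(1), of "w \<circ> transpose i (Suc i)"] by (simp add: comp_assoc)
  qed
qed

lemma longest_perm_apply: "longest_perm n i = (if i \<in> {1..n} then n + 1 - i else i)"
  by (auto simp: longest_perm_def one_line_def rev_nth simp del: upt_Suc)

lemma longest_perm_permutes: "longest_perm n permutes {1..n}"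
proof (rule bij_imp_permutes)
  show "bij_betw (longest_perm n) {1..n} {1..n}"
    by (rule bij_betw_byWitness[where f' = "longest_perm n"]) (auto simp: longest_perm_apply)
qed (auto simp: longest_perm_apply)

lemma transpose_Suc_permutes: "i \<in> {1..<n} \<Longrightarrow> transpose i (Suc i) permutes {1..n}"
  by (rule permutes_swap_id) auto

lemma schubert_rel_permutes: "schubert_rel n w f \<Longrightarrow> w permutes {1..n}"
proof (induction rule: schubert_rel.induct)
  case longest
  show ?case by (rule longest_perm_permutes)
next
  case (descend w f i)
  then show ?case by (intro permutes_compose transpose_Suc_permutes)
qed

text \<open>Along descents \<open>w j + j\<close> never increases; it is at most
  \<open>n + 1\<close> at \<open>j = 1\<close> and at least \<open>n + 1\<close> at
  \<open>j = n\<close>, hence constant.\<close>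

lemma no_ascent_longest:
  assumes w: "w permutes {1..n}" and desc: "\<And>i. i \<in> {1..<n} \<Longrightarrow> w (Suc i) < w i"
  shows "w = longest_perm n"
proof
  fix i
  have range: "w j \<in> {1..n} \<longleftrightarrow> j \<in> {1..n}" for j using permutes_in_image[OF w] .
  have upper: "w j + j \<le> n + 1" if "1 \<le> j" "j \<le> n" for j
    using that
  proof (induction j rule: nat_induct_at_least)
    case base
    then show ?case using range[of 1] by simp
  next
    case (Suc j)
    then show ?case using desc[of j] by simp
  qed
  have lower: "d < n \<Longrightarrow> n + 1 \<le> w (n - d) + (n - d)" for d
  proof (induction d)
    case 0
    then show ?case using range[of n] by simp
  next
    case (Suc d)
    define m where "m = n - Suc d"
    have m: "n - d = Suc m" "1 \<le> m" "m < n" using Suc(2) by (auto simp: m_def)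
    have "n + 1 \<le> w (Suc m) + Suc m" using Suc m by simp
    moreover have "w (Suc m) < w m" using desc[of m] m by simp
    ultimately show ?case unfolding m_def[symmetric] by linarith
  qed
  show "w i = longest_perm n i"
  proof (cases "i \<in> {1..n}")
    case True
    then show ?thesis using upper[of i] lower[of "n - i"] by (simp add: longest_perm_apply)
  next
    case False
    then show ?thesis using permutes_not_in[OF w, of i] by (auto simp: longest_perm_apply)
  qed
qed

lemma perm_length_le: "perm_length n w \<le> n * n"
proof -
  have "perm_length n w \<le> card ({1..n} \<times> {1..n})"
    unfolding perm_length_def by (rule card_mono) auto
  then show ?thesis by simp
qed

text \<open>Induction measure for climbing by ascents. The crude bound \<open>n * n\<close> on the
  length keeps the subtraction from truncating.\<close>

definition colength :: "nat \<Rightarrow> (nat \<Rightarrow> nat) \<Rightarrow> nat" where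
  "colength n w = n * n - perm_length n w"

lemma colength_ascent:
  assumes "i \<in> {1..<n}" "w i < w (Suc i)"
  shows "colength n (w \<circ> transpose i (Suc i)) < colength n w"
  using perm_length_ascent[OF assms] perm_length_le[of n "w \<circ> transpose i (Suc i)"]
  by (simp add: colength_def)

lemma schubert_rel_descend:
  assumes "schubert_rel n (w \<circ> transpose i (Suc i)) f" "i \<in> {1..<n}" "w i < w (Suc i)"
  shows "schubert_rel n w (divided_diff i f)"
proof -
  have "w \<circ> transpose i (Suc i) \<circ> transpose i (Suc i) = w" by (simp add: comp_assoc)
  then show ?thesis
    using schubert_rel.descend[OF assms(1,2)] perm_length_ascent[OF assms(2,3)] by simp
qed

text \<open>Any ascent leads up to a longer permutation; where no ascent is left, the permutation is
  the longest one.\<close>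

lemma schubert_rel_exists: "w permutes {1..n} \<Longrightarrow> \<exists>f. schubert_rel n w f"
proof (induction "colength n w" arbitrary: w rule: less_induct)
  case less
  show ?case
  proof (cases "\<exists>i\<in>{1..<n}. w i < w (Suc i)")
    case True
    then obtain i where i: "i \<in> {1..<n}" "w i < w (Suc i)" by blast
    obtain f where "schubert_rel n (w \<circ> transpose i (Suc i)) f"
      using less(1)[OF colength_ascent[OF i]] permutes_compose[OF transpose_Suc_permutes[OF i(1)] less(2)]
      by blast
    then show ?thesis using schubert_rel_descend i by blast
  next
    case False
    have "w (Suc i) < w i" if "i \<in> {1..<n}" for i
    proof -
      have "w i \<noteq> w (Suc i)" using permutes_inj[OF less(2)] by (metis injD n_not_Suc_n)
      then show ?thesis using False that by (meson linorder_neqE_nat)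
    qed
    then have "w = longest_perm n" using no_ascent_longest less(2) by blast
    then show ?thesis using schubert_rel.longest by blast
  qed
qed

lemma schubert_rel_cases:
  assumes "schubert_rel n w f"
  obtains "w = longest_perm n" "f = (\<Prod>i=1..<n. X i ^ (n - i))"
  | i g where "i \<in> {1..<n}" "w i < w (Suc i)" "schubert_rel n (w \<circ> transpose i (Suc i)) g"
      "f = divided_diff i g"
  using assms
proof cases
  case longest
  then show thesis by (rule that(1))
next
  case (descend v g i)
  have "v (Suc i) < v i"
    using perm_length_descent_iff[OF descend(4) schubert_rel_permutes[OF descend(3)]] descend(5) by blast
  moreover have "w \<circ> transpose i (Suc i) = v" by (simp add: descend comp_assoc)
  ultimately show thesis using that(2)[of i g] descend by simp
qed

text \<open>Two ascents of a permutation are joined by a common longer permutation, so the relations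
  between the divided differences give the same polynomial along both of them.\<close>

lemma schubert_rel_unique: "schubert_rel n w f \<Longrightarrow> schubert_rel n w g \<Longrightarrow> f = g"
proof (induction "colength n w" arbitrary: w f g rule: less_induct)
  case less
  note w = schubert_rel_permutes[OF less(2)]
  have IH: "p = q" if "i \<in> {1..<n}" "w i < w (Suc i)" "schubert_rel n (w \<circ> transpose i (Suc i)) p"
    "schubert_rel n (w \<circ> transpose i (Suc i)) q" for i p q
    using less(1)[OF colength_ascent[OF that(1,2)] that(3,4)] .
  have descents: "divided_diff i p = divided_diff j q"
    if "i < j" and i: "i \<in> {1..<n}" "w i < w (Suc i)" "schubert_rel n (w \<circ> transpose i (Suc i)) p"
      and j: "j \<in> {1..<n}" "w j < w (Suc j)" "schubert_rel n (w \<circ> transpose j (Suc j)) q" for i j p q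
  proof (cases "j = Suc i")
    case False
    with \<open>i < j\<close> have ij: "Suc i < j" by simp
    \<comment> \<open>Distant ascents: \<open>u\<close> lies above both neighbours of
      \<open>w\<close>, and the induction hypothesis identifies \<open>p\<close> and
      \<open>q\<close> with divided differences of one polynomial \<open>h\<close> of
      \<open>u\<close>.\<close>
    define u where "u = w \<circ> transpose i (Suc i) \<circ> transpose j (Suc j)"
    have u': "u = w \<circ> transpose j (Suc j) \<circ> transpose i (Suc i)"
      using ij by (auto simp: u_def fun_eq_iff transpose_def)
    have "u permutes {1..n}"
      unfolding u_def by (intro permutes_compose transpose_Suc_permutes i j w)
    then obtain h where h: "schubert_rel n u h" using schubert_rel_exists by blast
    have "schubert_rel n (w \<circ> transpose i (Suc i)) (divided_diff j h)"
      using h ij j by - (rule schubert_rel_descend, auto simp: u_def transpose_def)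
    then have "p = divided_diff j h" using IH i by blast
    moreover have "schubert_rel n (w \<circ> transpose j (Suc j)) (divided_diff i h)"
      using h ij i by - (rule schubert_rel_descend, auto simp: u' transpose_def)
    then have "q = divided_diff i h" using IH j by blast
    ultimately show ?thesis using divided_diff_commute[OF ij] by simp
  next
    case True
    let ?s = "transpose i (Suc i)" and ?t = "transpose (Suc i) (Suc (Suc i))"
    \<comment> \<open>Adjacent ascents: \<open>u\<close> is \<open>w\<close> times the longest
      element of the group generated by the two transpositions, whose two reduced words give the two
      sides of the braid relation.\<close>
    define u where "u = w \<circ> ?s \<circ> ?t \<circ> ?s"
    have u': "u = w \<circ> ?t \<circ> ?s \<circ> ?t"
      by (auto simp: u_def fun_eq_iff transpose_def)
    have asc: "w i < w (Suc i)" "w (Suc i) < w (Suc (Suc i))" and n: "Suc i \<in> {1..<n}"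
      using i j True by auto
    have "u permutes {1..n}"
      unfolding u_def by (intro permutes_compose transpose_Suc_permutes i n w)
    then obtain h where h: "schubert_rel n u h" using schubert_rel_exists by blast
    have "schubert_rel n (w \<circ> ?s \<circ> ?t) (divided_diff i h)"
      using h asc i(1) by - (rule schubert_rel_descend, auto simp: u_def transpose_def)
    then have "schubert_rel n (w \<circ> ?s) (divided_diff (Suc i) (divided_diff i h))"
      using asc n by - (rule schubert_rel_descend, auto simp: transpose_def)
    then have "p = divided_diff (Suc i) (divided_diff i h)" using IH i by blast
    moreover have "schubert_rel n (w \<circ> ?t \<circ> ?s) (divided_diff (Suc i) h)"
      using h asc n by - (rule schubert_rel_descend, auto simp: u' transpose_def)
    then have "schubert_rel n (w \<circ> ?t) (divided_diff i (divided_diff (Suc i) h))"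
      using asc i(1) by - (rule schubert_rel_descend, auto simp: transpose_def)
    then have "q = divided_diff i (divided_diff (Suc i) h)" using IH j True by blast
    ultimately show ?thesis using divided_diff_braid True by simp
  qed
  have longest: "\<not> longest_perm n i < longest_perm n (Suc i)" if "i \<in> {1..<n}" for i
    using that by (auto simp: longest_perm_apply)
  from less(2) show ?case
  proof (cases rule: schubert_rel_cases)
    case 1
    from less(3) show ?thesis
      by (cases rule: schubert_rel_cases) (use 1 longest in auto)
  next
    case i: (2 i p)
    from less(3) show ?thesis
    proof (cases rule: schubert_rel_cases)
      case 1
      then show ?thesis using i longest by auto
    next
      case j: (2 j q)
      consider "i < j" | "i = j" | "j < i" by linarith
      then show ?thesis
      proof cases
        case 1
        then show ?thesis using descents[OF 1 i(1-3) j(1-3)] i j by simp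
      next
        case 2
        then show ?thesis using IH[OF i(1-3)] i j by blast
      next
        case 3
        then show ?thesis using descents[OF 3 j(1-3) i(1-3)] i j by simp
      qed
    qed
  qed
qed

lemma schubert_eqI: "schubert_rel n w f \<Longrightarrow> schubert n w = f"
  unfolding schubert_def using schubert_rel_unique by blast

section \<open>Flagged determinants\<close>

text \<open>The complete homogeneous symmetric polynomials, as coefficients of \<open>\<Prod>q\<in>S. 1 / (1 - x_q z)\<close>.\<close>

definition hom_sym :: "nat set \<Rightarrow> int \<Rightarrow> zpoly" where
  "hom_sym S m = (if m < 0 then 0 else fps_nth (\<Prod>q\<in>S. Abs_fps (\<lambda>k. X q ^ k)) (nat m))"

lemma hom_sym_neg: "m < 0 \<Longrightarrow> hom_sym S m = 0"
  by (simp add: hom_sym_def)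

lemma hom_sym_empty: "hom_sym {} m = (if m = 0 then 1 else 0)"
  by (simp add: hom_sym_def)

text \<open>The geometric series satisfies \<open>G = 1 + x_q z G\<close>: a monomial either avoids
  \<open>x_q\<close> or is divisible by it.\<close>

lemma hom_sym_insert:
  assumes "finite S" "q \<notin> S"
  shows "hom_sym (insert q S) m = hom_sym S m + X q * hom_sym (insert q S) (m - 1)"
proof -
  define G where "G = Abs_fps (\<lambda>k. X q ^ k)"
  define P where "P = (\<Prod>q\<in>S. Abs_fps (\<lambda>k. X q ^ k))"
  have G: "G = 1 + fps_const (X q) * (fps_X * G)"
    by (rule fps_ext) (simp add: G_def power_eq_if)
  have eq: "P * G = P + fps_const (X q) * (fps_X * (P * G))"
  proof -
    have "P * G = P * (1 + fps_const (X q) * (fps_X * G))" using G by (rule arg_cong)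
    also have "\<dots> = P + fps_const (X q) * (fps_X * (P * G))" by (simp add: algebra_simps)
    finally show ?thesis .
  qed
  have "fps_nth (P * G) k = fps_nth P k + X q * (if k = 0 then 0 else fps_nth (P * G) (k - 1))" for k
    by (subst eq) simp
  moreover have "(\<Prod>q\<in>insert q S. Abs_fps (\<lambda>k. X q ^ k)) = P * G"
    using assms by (simp add: P_def G_def mult.commute)
  ultimately show ?thesis
    by (auto simp: hom_sym_def nat_diff_distrib simp flip: P_def)
qed

lemma hom_sym_zero: "finite S \<Longrightarrow> hom_sym S 0 = 1"
proof (induction S rule: finite_induct)
  case (insert q S)
  then show ?case using hom_sym_insert[of S q 0] by (simp add: hom_sym_neg)
qed (simp add: hom_sym_empty)

lemma hom_sym_single: "hom_sym {q} (int m) = X q ^ m"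
proof (induction m)
  case (Suc m)
  then show ?case using hom_sym_insert[of "{}" q "int (Suc m)"] by (simp add: hom_sym_empty)
qed (simp add: hom_sym_zero)

lemma swap_hom_sym: "finite S \<Longrightarrow> swap i (hom_sym S m) = hom_sym (transpose i (Suc i) ` S) m"
proof (induction S arbitrary: m rule: finite_induct)
  case empty
  show ?case by (simp add: hom_sym_empty subst_hom)
next
  case (insert q S)
  have notin: "transpose i (Suc i) q \<notin> transpose i (Suc i) ` S"
    using insert(2) by (metis imageE transpose_involutory)
  \<comment> \<open>The recursion lowers the degree but keeps the set, hence a second induction, on
    the degree.\<close>
  have "swap i (hom_sym (insert q S) (int k)) = hom_sym (transpose i (Suc i) ` insert q S) (int k)" for k
  proof (induction k)
    case 0
    show ?case using insert(1) by (simp add: hom_sym_zero subst_hom)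
  next
    case (Suc k)
    have "swap i (hom_sym (insert q S) (int (Suc k))) =
       swap i (hom_sym S (int (Suc k))) + X (transpose i (Suc i) q) * swap i (hom_sym (insert q S) (int k))"
      by (subst hom_sym_insert) (use insert in \<open>simp_all add: subst_hom\<close>)
    also have "\<dots> = hom_sym (transpose i (Suc i) ` insert q S) (int (Suc k))"
      unfolding Suc insert(3) image_insert
      using hom_sym_insert[OF finite_imageI[OF insert(1)] notin, of "int (Suc k)"] by simp
    finally show ?case .
  qed
  then show ?case by (cases m) (simp_all add: hom_sym_neg subst_hom)
qed

text \<open>Counts the monomials of degree \<open>a - p\<close> in \<open>p + 1\<close> variables.
  With the degree in this form \<open>hom_sym_insert\<close> becomes Pascal's rule, and negative
  degrees match vanishing binomials.\<close>

lemma subst_hom_sym: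
  assumes "finite S" "card S = Suc p"
  shows "subst (\<lambda>_. 1) (hom_sym S (int a - int p)) = of_nat (a choose p)"
  using assms
proof (induction p arbitrary: S a)
  case 0
  then obtain q where "S = {q}" using card_1_singletonE by (metis One_nat_def)
  then show ?case by (simp add: hom_sym_single subst_hom)
next
  case (Suc p)
  then obtain q S' where S: "S = insert q S'" "q \<notin> S'" "finite S'" "card S' = Suc p"
    by (metis card_Suc_eq finite_insert)
  note IH = Suc.IH[OF S(3,4)]
  show ?case
  proof (induction a)
    case 0
    then show ?case by (simp add: hom_sym_neg subst_hom)
  next
    case (Suc a)
    have "int (Suc a) - int (Suc p) = int a - int p" "int a - int p - 1 = int a - int (Suc p)"
      by simp_all
    then have split: "subst (\<lambda>_. 1) (hom_sym S (int (Suc a) - int (Suc p))) =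
       subst (\<lambda>_. 1) (hom_sym S' (int a - int p)) + subst (\<lambda>_. 1) (hom_sym S (int a - int (Suc p)))"
      unfolding S(1) using hom_sym_insert[OF S(3,2), of "int a - int p"]
      by (simp only: subst_hom mult_1_left)
    show ?case
      unfolding split Suc IH by simp
  qed
qed

text \<open>Expand \<open>hom_sym {1..Suc p} m\<close> once by removing \<open>Suc p\<close> and
  once by removing \<open>p\<close>, and subtract.\<close>

lemma hom_sym_diff_swap:
  assumes "p \<ge> 1"
  shows "(X p - X (Suc p)) * hom_sym {1..Suc p} (m - 1) = hom_sym {1..p} m - swap p (hom_sym {1..p} m)"
proof -
  define S where "S = {1..<p}"
  have sets: "{1..p} = insert p S" "{1..Suc p} = insert (Suc p) (insert p S)"
    "{1..Suc p} = insert p (insert (Suc p) S)"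
    using assms by (auto simp: S_def)
  have "transpose p (Suc p) ` insert p S = insert (Suc p) S"
    by (auto simp: S_def transpose_def image_iff)
  then have "swap p (hom_sym {1..p} m) = hom_sym (insert (Suc p) S) m"
    unfolding sets by (subst swap_hom_sym) (auto simp: S_def)
  moreover have "hom_sym {1..Suc p} m = hom_sym {1..p} m + X (Suc p) * hom_sym {1..Suc p} (m - 1)"
    unfolding sets(1,2) by (rule hom_sym_insert) (auto simp: S_def)
  moreover have "hom_sym {1..Suc p} m = hom_sym (insert (Suc p) S) m + X p * hom_sym {1..Suc p} (m - 1)"
    unfolding sets(3) by (rule hom_sym_insert) (auto simp: S_def)
  ultimately show ?thesis by (simp add: algebra_simps)
qed

text \<open>The interval contains both of \<open>p\<close> and \<open>Suc p\<close> or neither, so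
  the transposition maps it to itself.\<close>

lemma swap_hom_sym_interval: "q \<noteq> p \<Longrightarrow> p \<ge> 1 \<Longrightarrow> swap p (hom_sym {1..q} m) = hom_sym {1..q} m"
proof -
  assume "q \<noteq> p" "p \<ge> 1"
  then have "transpose p (Suc p) j \<in> {1..q}" if "j \<in> {1..q}" for j
    using that by (auto simp: transpose_def)
  then have "transpose p (Suc p) ` {1..q} = {1..q}"
    by (metis image_eqI image_subsetI subsetI subset_antisym transpose_involutory)
  then show ?thesis by (simp add: swap_hom_sym)
qed

text \<open>A weakly increasing sequence of \<open>a + j\<close> indices, the \<open>i\<close>-th of them plotted against \<open>i\<close>, crosses a given
  antidiagonal at exactly one \<open>l\<close>: the first \<open>j - l\<close> indices are at most \<open>s + l\<close>, the others at least
  \<open>s + l\<close>. This factors the initial determinant into triangular ones.\<close>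

lemma hom_sym_split:
  "s \<le> Suc e \<Longrightarrow> int s \<le> a + int e \<Longrightarrow> hom_sym {s..e} (a + int j) =
     (\<Sum>l\<le>j. hom_sym {s + l..e} (a + int l) * hom_sym {s..s + l} (int j - int l))"
proof (induction j arbitrary: s a)
  case 0
  show ?case by (simp add: hom_sym_zero)
next
  case (Suc j)
  show ?case
  proof (cases "s = Suc e")
    case True
    \<comment> \<open>The intervals ending at \<open>e\<close> are empty, and their degrees are
      positive by the second hypothesis, so both sides vanish.\<close>
    with Suc(3) show ?thesis by (simp add: hom_sym_empty)
  next
    case False
    with Suc(2) have s: "s \<le> e" by simp
    have split: "hom_sym {s..t} m = hom_sym {Suc s..t} m + X s * hom_sym {s..t} (m - 1)"
      if "s \<le> t" for t m
    proof -
      have "{s..t} = insert s {Suc s..t}" using that by auto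
      then show ?thesis using hom_sym_insert[of "{Suc s..t}" s m] by simp
    qed
    \<comment> \<open>Split the second factor by whether \<open>x_s\<close> occurs. The part without
      it falls under the induction hypothesis for \<open>Suc s\<close> and \<open>a + 1\<close>, the
      part with it under that for \<open>s\<close> and \<open>a\<close>.\<close>
    have "(\<Sum>l\<le>Suc j. hom_sym {s + l..e} (a + int l) * hom_sym {s..s + l} (int (Suc j) - int l)) =
      (\<Sum>l\<le>Suc j. hom_sym {s + l..e} (a + int l) * hom_sym {Suc s..s + l} (int (Suc j) - int l)) +
      X s * (\<Sum>l\<le>Suc j. hom_sym {s + l..e} (a + int l) * hom_sym {s..s + l} (int j - int l))"
    proof -
      have "hom_sym {s..s + l} (int (Suc j) - int l) =
          hom_sym {Suc s..s + l} (int (Suc j) - int l) + X s * hom_sym {s..s + l} (int j - int l)" for l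
        using split[of "s + l" "int (Suc j) - int l"] by simp
      then show ?thesis
        by (simp only: distrib_left sum.distrib sum_distrib_left mult.left_commute)
    qed
    also have "(\<Sum>l\<le>Suc j. hom_sym {s + l..e} (a + int l) * hom_sym {Suc s..s + l} (int (Suc j) - int l)) =
      (\<Sum>l\<le>j. hom_sym {Suc s + l..e} (a + 1 + int l) * hom_sym {Suc s..Suc s + l} (int j - int l))"
      by (subst sum.atMost_Suc_shift) (simp add: hom_sym_empty add.assoc)
    also have "\<dots> = hom_sym {Suc s..e} (a + 1 + int j)"
      using Suc(1)[of "Suc s" "a + 1"] Suc(3) s by simp
    also have "(\<Sum>l\<le>Suc j. hom_sym {s + l..e} (a + int l) * hom_sym {s..s + l} (int j - int l)) =
      (\<Sum>l\<le>j. hom_sym {s + l..e} (a + int l) * hom_sym {s..s + l} (int j - int l))"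
      by (simp add: hom_sym_neg)
    also have "\<dots> = hom_sym {s..e} (a + int j)"
      using Suc(1)[of s a] Suc(2,3) by simp
    also have "hom_sym {Suc s..e} (a + 1 + int j) + X s * hom_sym {s..e} (a + int j) =
        hom_sym {s..e} (a + int (Suc j))"
      using split[OF s, of "a + int (Suc j)"] by (simp add: algebra_simps)
    finally show ?thesis by simp
  qed
qed

section \<open>Determinants with a flag for each row\<close>

definition flag_mat :: "nat \<Rightarrow> (nat \<Rightarrow> nat) \<Rightarrow> zpoly mat" where
  "flag_mat n \<phi> = mat n n (\<lambda>(r, j). hom_sym {1..\<phi> r} (int n - int r - int (\<phi> r) + int j))"

lemma flag_mat_carrier: "flag_mat n \<phi> \<in> carrier_mat n n"
  by (simp add: flag_mat_def)

lemma flag_mat_cong: "(\<And>r. r < n \<Longrightarrow> \<phi> r = \<psi> r) \<Longrightarrow> flag_mat n \<phi> = flag_mat n \<psi>"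
  by (auto simp: flag_mat_def intro!: eq_matI)

lemma subst_det:
  assumes "A \<in> carrier_mat n n"
  shows "subst a (det A) = det (map_mat (subst a) A)"
proof -
  interpret comm_ring_hom "subst a"
    by unfold_locales (simp_all add: subst_hom)
  show ?thesis by simp
qed

text \<open>By \<open>hom_sym_diff_swap\<close> the flag rises by one while the degree drops by one,
  which is why the degrees in \<open>flag_mat\<close> contain \<open>- \<phi> r\<close>. The other
  rows are symmetric in the two variables and pull out of every term of the Leibniz
  expansion.\<close>

lemma divided_diff_det_flag_mat:
  assumes r: "r < n" and p: "\<phi> r = p" "p \<ge> 1"
    and other: "\<And>q. q < n \<Longrightarrow> q \<noteq> r \<Longrightarrow> \<phi> q \<noteq> p"
  shows "divided_diff p (det (flag_mat n \<phi>)) = det (flag_mat n (\<phi>(r := Suc p)))"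
proof (rule divided_diff_eqI)
  define M where "M = flag_mat n \<phi>"
  define N where "N = flag_mat n (\<phi>(r := Suc p))"
  have car: "M \<in> carrier_mat n n" "N \<in> carrier_mat n n" "map_mat (swap p) M \<in> carrier_mat n n"
    by (simp_all add: M_def N_def flag_mat_carrier)
  have row_r: "(X p - X (Suc p)) * N $$ (r, j) = M $$ (r, j) - swap p (M $$ (r, j))" if "j < n" for j
    using r that p hom_sym_diff_swap[of p "int n - int r - int p + int j"]
    by (simp add: M_def N_def flag_mat_def algebra_simps)
  have row_q: "N $$ (q, j) = M $$ (q, j)" "swap p (M $$ (q, j)) = M $$ (q, j)"
    if "q < n" "q \<noteq> r" "j < n" for q j
    using that other[of q] p swap_hom_sym_interval[of "\<phi> q" p] by (simp_all add: M_def N_def flag_mat_def)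
  have summand: "(X p - X (Suc p)) * (\<Prod>i = 0..<n. N $$ (i, \<pi> i)) =
      (\<Prod>i = 0..<n. M $$ (i, \<pi> i)) - (\<Prod>i = 0..<n. map_mat (swap p) M $$ (i, \<pi> i))"
    if "\<pi> permutes {0..<n}" for \<pi>
  proof -
    have lt: "\<pi> i < n" if "i < n" for i
      using permutes_in_image[OF \<open>\<pi> permutes {0..<n}\<close>, of i] that by simp
    define Q where "Q = (\<Prod>i\<in>{0..<n} - {r}. M $$ (i, \<pi> i))"
    have "(\<Prod>i = 0..<n. N $$ (i, \<pi> i)) = N $$ (r, \<pi> r) * Q"
      "(\<Prod>i = 0..<n. M $$ (i, \<pi> i)) = M $$ (r, \<pi> r) * Q"
      "(\<Prod>i = 0..<n. map_mat (swap p) M $$ (i, \<pi> i)) = swap p (M $$ (r, \<pi> r)) * Q"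
      using r lt car row_q by (simp_all add: prod.remove[of _ r] Q_def)
    then show ?thesis using row_r[OF lt[OF r]]
      by (simp only: mult.assoc[symmetric] left_diff_distrib)
  qed
  show "(X p - X (Suc p)) * det N = det M - swap p (det M)"
  proof -
    have "(X p - X (Suc p)) * det N =
        (\<Sum>\<pi> | \<pi> permutes {0..<n}. signof \<pi> * ((X p - X (Suc p)) * (\<Prod>i = 0..<n. N $$ (i, \<pi> i))))"
      unfolding det_def'[OF car(2)] by (simp only: sum_distrib_left mult.left_commute)
    also have "\<dots> = (\<Sum>\<pi> | \<pi> permutes {0..<n}. signof \<pi> *
        ((\<Prod>i = 0..<n. M $$ (i, \<pi> i)) - (\<Prod>i = 0..<n. map_mat (swap p) M $$ (i, \<pi> i))))"
      by (intro sum.cong refl) (simp only: summand mem_Collect_eq)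
    also have "\<dots> = det M - det (map_mat (swap p) M)"
      unfolding det_def'[OF car(1)] det_def'[OF car(3)] by (simp only: right_diff_distrib sum_subtractf)
    finally show ?thesis unfolding subst_det[OF car(1)] .
  qed
qed

text \<open>\<open>hom_sym_split\<close> with \<open>s = 1\<close> and \<open>e = Suc r\<close> is a
  factorization into a lower triangular \<open>T\<close>, whose diagonal carries powers of single
  variables, and an upper unitriangular \<open>U\<close>.\<close>

lemma det_flag_mat_Suc: "det (flag_mat n Suc) = (\<Prod>i=1..<n. X i ^ (n - i))"
proof -
  define T where "T = mat n n (\<lambda>(r, l). hom_sym {1 + l..Suc r} (int n - int r - int (Suc r) + int l))"
  define U where "U = mat n n (\<lambda>(l, j). hom_sym {1..1 + l} (int j - int l))"
  have car: "T \<in> carrier_mat n n" "U \<in> carrier_mat n n" by (simp_all add: T_def U_def)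
  have "flag_mat n Suc = T * U"
  proof (rule eq_matI)
    fix r j assume "r < dim_row (T * U)" "j < dim_col (T * U)"
    then have rj: "r < n" "j < n" using car by auto
    have "hom_sym {1..Suc r} (int n - int r - int (Suc r) + int j) =
      (\<Sum>l\<le>j. hom_sym {1 + l..Suc r} (int n - int r - int (Suc r) + int l) * hom_sym {1..1 + l} (int j - int l))"
      using rj by (intro hom_sym_split) auto
    \<comment> \<open>For \<open>l > j\<close> the second factor has negative degree.\<close>
    also have "\<dots> = (\<Sum>l<n. hom_sym {1 + l..Suc r} (int n - int r - int (Suc r) + int l) * hom_sym {1..1 + l} (int j - int l))"
      by (rule sum.mono_neutral_left) (use rj in \<open>auto simp: hom_sym_neg\<close>)
    finally show "flag_mat n Suc $$ (r, j) = (T * U) $$ (r, j)"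
      using rj by (simp add: flag_mat_def T_def U_def scalar_prod_def lessThan_atLeast0)
  qed (use car in \<open>auto simp: flag_mat_def\<close>)
  then have "det (flag_mat n Suc) = det T * det U" using car det_mult by metis
  moreover have "det U = 1"
    using det_upper_triangular[OF _ car(2)]
    by (auto simp: U_def upper_triangular_def prod_list_diag_prod hom_sym_neg hom_sym_zero)
  moreover have "det T = (\<Prod>r<n. X (Suc r) ^ (n - Suc r))"
  proof -
    have diag: "hom_sym {Suc r} (int n - int r - int (Suc r) + int r) = X (Suc r) ^ (n - Suc r)" if "r < n" for r
    proof -
      have "int n - int r - int (Suc r) + int r = int (n - Suc r)" using that by simp
      then show ?thesis by (simp only: hom_sym_single)
    qed
    have "det T = (\<Prod>r<n. T $$ (r, r))"
      using det_lower_triangular[OF _ car(1)] car(1)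
      by (auto simp: T_def prod_list_diag_prod hom_sym_empty lessThan_atLeast0)
    also have "\<dots> = (\<Prod>r<n. X (Suc r) ^ (n - Suc r))"
      using diag by (intro prod.cong) (simp_all add: T_def)
    finally show ?thesis .
  qed
  moreover have "(\<Prod>r<n. X (Suc r) ^ (n - Suc r)) = (\<Prod>i=1..<n. X i ^ (n - i))"
  proof (cases n)
    case (Suc m)
    have "(\<Prod>r<m. X (Suc r) ^ (n - Suc r)) = (\<Prod>i=1..<n. X i ^ (n - i))"
      by (rule prod.reindex_bij_witness[of _ "\<lambda>i. i - 1" Suc]) (use Suc in auto)
    then show ?thesis by (simp add: Suc)
  qed simp
  ultimately show ?thesis by simp
qed

section \<open>The unimodal permutations\<close>

lemma one_line_swap:
  "one_line (us @ a # b # vs) \<circ> transpose (Suc (length us)) (Suc (Suc (length us))) =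
   one_line (us @ b # a # vs)"
proof
  fix i
  show "(one_line (us @ a # b # vs) \<circ> transpose (Suc (length us)) (Suc (Suc (length us)))) i =
     one_line (us @ b # a # vs) i"
    by (cases "i = Suc (length us)"; cases "i = Suc (Suc (length us))")
      (auto simp: one_line_def nth_append nth_Cons split: nat.splits)
qed

lemma schubert_rel_one_line:
  assumes "schubert_rel n (one_line (us @ b # a # vs)) f" "a < b" "n = length us + length vs + 2"
  shows "schubert_rel n (one_line (us @ a # b # vs)) (divided_diff (Suc (length us)) f)"
  by (rule schubert_rel_descend)
    (use assms in \<open>auto simp: one_line_swap one_line_def nth_append\<close>)

text \<open>The one-line words of \<open>w_minus\<close> (even length) and \<open>w_plus\<close>
  (odd length), built by inserting each new maximum at the peak.\<close>

fun unimodal_word :: "nat \<Rightarrow> nat list" where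
  "unimodal_word 0 = []"
| "unimodal_word (Suc m) =
     take (m div 2) (unimodal_word m) @ Suc m # drop (m div 2) (unimodal_word m)"

lemma length_unimodal_word: "length (unimodal_word m) = m"
  by (induction m) auto

lemma set_unimodal_word: "set (unimodal_word m) = {1..m}"
proof (induction m)
  case (Suc m)
  have "set (unimodal_word (Suc m)) = insert (Suc m) (set (take (m div 2) (unimodal_word m) @ drop (m div 2) (unimodal_word m)))"
    by (simp del: append_take_drop_id)
  also have "\<dots> = {1..Suc m}" unfolding append_take_drop_id Suc by auto
  finally show ?case .
qed simp

text \<open>Both \<open>2 * k + 1\<close> and \<open>2 * k + 2\<close> are inserted at position
  \<open>k\<close>, between the even and the odd values.\<close>

lemma unimodal_word_eq:
  "unimodal_word (2 * k) = map (\<lambda>i. 2 * i) [1..<Suc k] @ rev (map (\<lambda>i. 2 * i + 1) [0..<k]) \<and>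
   unimodal_word (2 * k + 1) = map (\<lambda>i. 2 * i) [1..<Suc k] @ rev (map (\<lambda>i. 2 * i + 1) [0..<Suc k])"
proof -
  have odd: "unimodal_word (2 * k + 1) = map (\<lambda>i. 2 * i) [1..<Suc k] @ rev (map (\<lambda>i. 2 * i + 1) [0..<Suc k])"
    if "unimodal_word (2 * k) = map (\<lambda>i. 2 * i) [1..<Suc k] @ rev (map (\<lambda>i. 2 * i + 1) [0..<k])" for k
    using that by (simp del: upt_Suc) simp
  have "unimodal_word (2 * k) = map (\<lambda>i. 2 * i) [1..<Suc k] @ rev (map (\<lambda>i. 2 * i + 1) [0..<k])"
  proof (induction k)
    case (Suc k)
    have "unimodal_word (2 * Suc k) = unimodal_word (Suc (2 * k + 1))" by simp
    also have "\<dots> = take k (unimodal_word (2 * k + 1)) @ Suc (2 * k + 1) # drop k (unimodal_word (2 * k + 1))"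
      by (subst unimodal_word.simps) simp
    finally show ?case unfolding odd[OF Suc] by (simp del: upt_Suc) simp
  qed simp
  with odd show ?thesis by blast
qed

text \<open>Row \<open>r\<close> belongs to the value \<open>n - r\<close>, which starts at position
  \<open>r + 1\<close> of the decreasing word and moves right past \<open>(n - 1 - r) div 2\<close>
  smaller values.\<close>

definition final_flag :: "nat \<Rightarrow> nat \<Rightarrow> nat" where
  "final_flag n r = r + 1 + (n - 1 - r) div 2"

text \<open>Induction on the number of values already inserted; the larger values still stand
  decreasing in front, and their rows keep the initial flags. The inner induction moves
  \<open>m + 1\<close> to its place, one divided difference per step, all acting on row
  \<open>R\<close>.\<close>

lemma schubert_rel_partial:
  "m \<le> n \<Longrightarrow> schubert_rel n (one_line (rev [Suc m..<Suc n] @ unimodal_word m))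
     (det (flag_mat n (\<lambda>r. if r < n - m then Suc r else final_flag n r)))"
proof (induction m)
  case 0
  have "flag_mat n (\<lambda>r. if r < n - 0 then Suc r else final_flag n r) = flag_mat n Suc"
    by (rule flag_mat_cong) simp
  then show ?case
    using schubert_rel.longest[of n] by (simp add: det_flag_mat_Suc longest_perm_def del: upt_Suc)
next
  case (Suc m)
  define W where "W = unimodal_word m"
  define R where "R = n - Suc m"
  define \<phi> where "\<phi> s = (\<lambda>r. if r < R then Suc r else if r = R then Suc R + s else final_flag n r)" for s
  have W: "length W = m" "\<And>i. i < m \<Longrightarrow> W ! i \<le> m"
    using nth_mem[of _ W] by (auto simp: W_def length_unimodal_word set_unimodal_word)
  have "schubert_rel n (one_line (rev [Suc (Suc m)..<Suc n] @ take s W @ Suc m # drop s W))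
     (det (flag_mat n (\<phi> s)))" if "s \<le> m div 2" for s
    using that
  proof (induction s)
    case 0
    have "flag_mat n (\<phi> 0) = flag_mat n (\<lambda>r. if r < n - m then Suc r else final_flag n r)"
      by (rule flag_mat_cong) (use Suc.prems in \<open>auto simp: \<phi>_def R_def\<close>)
    then show ?case
      using Suc by (simp add: W_def upt_conv_Cons del: upt_Suc)
  next
    case (Suc s)
    then have s: "s < m" by simp
    define us where "us = rev [Suc (Suc m)..<Suc n] @ take s W"
    have len: "length us = R + s" using s W by (simp add: us_def R_def del: upt_Suc)
    have take: "take (Suc s) W = take s W @ [W ! s]" and drop: "drop s W = W ! s # drop (Suc s) W"
      using s W(1) by (simp_all add: take_Suc_conv_app_nth Cons_nth_drop_Suc)
    have "schubert_rel n (one_line (us @ Suc m # W ! s # drop (Suc s) W)) (det (flag_mat n (\<phi> s)))"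
      using Suc unfolding drop us_def by simp
    moreover have "W ! s < Suc m" using W(2)[OF s] by simp
    ultimately have "schubert_rel n (one_line (us @ W ! s # Suc m # drop (Suc s) W))
        (divided_diff (Suc (length us)) (det (flag_mat n (\<phi> s))))"
      by (rule schubert_rel_one_line) (use len s W \<open>Suc m \<le> n\<close> in \<open>simp add: R_def\<close>)
    moreover have "divided_diff (Suc R + s) (det (flag_mat n (\<phi> s))) =
        det (flag_mat n ((\<phi> s)(R := Suc (Suc R + s))))"
    proof (rule divided_diff_det_flag_mat)
      show "R < n" using \<open>Suc m \<le> n\<close> by (simp add: R_def)
      \<comment> \<open>Rows above \<open>R\<close> have flags at most \<open>R\<close>. Rows below
        it have flags at least \<open>R + 1 + m div 2\<close>, which exceeds the current flag
        because \<open>s < m div 2\<close>.\<close>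
      show "\<phi> s q \<noteq> Suc R + s" if "q < n" "q \<noteq> R" for q
      proof (cases "q < R")
        case False
        then have "n - 1 - q \<ge> m - (q - R)" "q > R" using that \<open>Suc m \<le> n\<close> by (auto simp: R_def)
        then show ?thesis using Suc.prems by (simp add: \<phi>_def final_flag_def)
      qed (simp add: \<phi>_def)
    qed (simp_all add: \<phi>_def)
    moreover have "(\<phi> s)(R := Suc (Suc R + s)) = \<phi> (Suc s)"
      by (auto simp: \<phi>_def)
    ultimately show ?case unfolding take us_def[symmetric] len by (simp add: us_def)
  qed
  from this[of "m div 2"]
  have "schubert_rel n (one_line (rev [Suc (Suc m)..<Suc n] @ unimodal_word (Suc m))) (det (flag_mat n (\<phi> (m div 2))))"
    by (simp add: W_def del: upt_Suc)
  moreover have "\<phi> (m div 2) = (\<lambda>r. if r < n - Suc m then Suc r else final_flag n r)"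
    using Suc.prems by (auto simp: \<phi>_def R_def final_flag_def)
  ultimately show ?case by simp
qed

lemma schubert_unimodal: "schubert n (one_line (unimodal_word n)) = det (flag_mat n (final_flag n))"
  using schubert_rel_partial[of n n] by (intro schubert_eqI) simp

section \<open>Gaussian elimination of the specialized determinant\<close>

text \<open>The ratios \<open>p_(n+1) / p_(n-1)\<close> of the pivots: the solution of the linear recurrence
  \<open>pivot_quot_rec\<close>, which makes the differential system for the remainders consistent.\<close>

definition pivot_quot :: "nat \<Rightarrow> rat" where
  "pivot_quot n = (let m = of_nat (n div 2) in
     if even n then 6 * (6*m - 1) * (3*m + 1) / ((8*m + 2) * (8*m - 2))
     else 6 * (6*m + 1) * (3*m + 2) / ((8*m + 6) * (8*m + 2)))"

fun pivot :: "nat \<Rightarrow> rat" where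
  "pivot 0 = 1"
| "pivot (Suc 0) = 1"
| "pivot (Suc (Suc n)) = pivot_quot (Suc n) * pivot n"

lemma eight_m_nonzero: "8 * rat_of_nat m - 2 \<noteq> 0" "8 * rat_of_nat m + 2 \<noteq> 0" "8 * rat_of_nat m + 6 \<noteq> 0"
proof -
  have "8 * int m - 2 \<noteq> 0" by presburger
  then have "rat_of_int (8 * int m - 2) \<noteq> 0" by (simp only: of_int_eq_0_iff not_False_eq_True)
  then show "8 * rat_of_nat m - 2 \<noteq> 0" by simp
  have "8 * rat_of_nat m + 2 > 0" "8 * rat_of_nat m + 6 > 0"
    by (intro add_nonneg_pos; simp)+
  then show "8 * rat_of_nat m + 2 \<noteq> 0" "8 * rat_of_nat m + 6 \<noteq> 0" by auto
qed

lemma pivot_quot_even: "pivot_quot (2 * m) =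
    6 * (6 * of_nat m - 1) * (3 * of_nat m + 1) / ((8 * of_nat m + 2) * (8 * of_nat m - 2))"
  by (simp add: pivot_quot_def Let_def)

lemma pivot_quot_odd: "pivot_quot (Suc (2 * m)) =
    6 * (6 * of_nat m + 1) * (3 * of_nat m + 2) / ((8 * of_nat m + 6) * (8 * of_nat m + 2))"
  by (simp add: pivot_quot_def Let_def)

lemma six_m_nonzero: "6 * rat_of_nat m - 1 \<noteq> 0"
proof -
  have "6 * int m - 1 \<noteq> 0" by presburger
  then have "rat_of_int (6 * int m - 1) \<noteq> 0" by (simp only: of_int_eq_0_iff not_False_eq_True)
  then show ?thesis by simp
qed

lemma pivot_quot_nonzero: "pivot_quot n \<noteq> 0"
proof (cases "even n")
  case True
  then obtain m where n: "n = 2 * m" by blast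
  have "3 * rat_of_nat m + 1 > 0" by (intro add_nonneg_pos; simp)
  then show ?thesis unfolding n pivot_quot_even using six_m_nonzero[of m] eight_m_nonzero[of m] by simp
next
  case False
  then obtain m where n: "n = Suc (2 * m)" using oddE by (metis Suc_eq_plus1)
  have "3 * rat_of_nat m + 2 > 0" "6 * rat_of_nat m + 1 > 0" by (intro add_nonneg_pos; simp)+
  then show ?thesis unfolding n pivot_quot_odd using eight_m_nonzero[of m] by simp
qed

lemma pivot_nonzero: "pivot n \<noteq> 0"
  by (induction n rule: pivot.induct) (use pivot_quot_nonzero in auto)

text \<open>The inhomogeneous term equals \<open>27 + slope n - slope (Suc n)\<close>, as
  \<open>coupling_Suc_Suc\<close> demands.\<close>

lemma pivot_quot_rec:
  "(4 * of_nat n + 6) * pivot_quot (Suc n) =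
   (4 * of_nat n - 2) * pivot_quot n + (if even n then 9 else 18)"
proof (cases "even n")
  case True
  then obtain m where n: "n = 2 * m" by blast
  show ?thesis unfolding n pivot_quot_even pivot_quot_odd
    using eight_m_nonzero[of m] by (simp add: divide_simps) (simp add: algebra_simps)
next
  case False
  then obtain m where n: "n = Suc (2 * m)" using oddE by (metis Suc_eq_plus1)
  define a where "a = rat_of_nat m"
  have Suc_n: "Suc n = 2 * Suc m" using n by simp
  have nz: "8 * a + 6 \<noteq> 0" "8 * a + 2 \<noteq> 0" "8 * a + 10 \<noteq> 0"
    using eight_m_nonzero[of m] eight_m_nonzero(2)[of "Suc m"] by (simp_all add: a_def)
  have "pivot_quot (Suc n) = 6 * (6 * a + 5) * (3 * a + 4) / ((8 * a + 10) * (8 * a + 6))"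
    unfolding Suc_n pivot_quot_even by (simp add: a_def algebra_simps)
  moreover have "pivot_quot n = 6 * (6 * a + 1) * (3 * a + 2) / ((8 * a + 6) * (8 * a + 2))"
    unfolding n pivot_quot_odd by (simp add: a_def)
  moreover have "rat_of_nat n = 2 * a + 1" by (simp add: n a_def)
  ultimately have "pivot_quot (Suc n) * ((8 * a + 10) * (8 * a + 6)) = 6 * (6 * a + 5) * (3 * a + 4)"
    "pivot_quot n * ((8 * a + 6) * (8 * a + 2)) = 6 * (6 * a + 1) * (3 * a + 2)"
    and an: "rat_of_nat n = 2 * a + 1"
    using nz by simp_all
  note h = this
  have "(8 * a + 6) * ((4 * of_nat n + 6) * pivot_quot (Suc n)) =
      pivot_quot (Suc n) * ((8 * a + 10) * (8 * a + 6))"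
    by (simp add: an algebra_simps)
  also have "\<dots> = 6 * (6 * a + 1) * (3 * a + 2) + 18 * (8 * a + 6)"
    unfolding h(1) by (simp add: algebra_simps)
  also have "\<dots> = (8 * a + 6) * ((4 * of_nat n - 2) * pivot_quot n + 18)"
    unfolding h(2)[symmetric] an by (simp add: algebra_simps)
  finally show ?thesis using nz False by simp
qed

definition slope :: "nat \<Rightarrow> rat" where
  "slope n = (if even n then 27 * of_nat (n div 2) - 9 else 27 * of_nat (n div 2) + 9)"

text \<open>A coefficient of the system \<open>theta_remainder\<close>. At 0 no earlier pivot
  exists, and the value -3 is read off from \<open>theta 1\<close>.\<close>

definition coupling :: "nat \<Rightarrow> rat" where
  "coupling n = (if n = 0 then -3 else (4 * of_nat n - 2) * pivot n / pivot (n - 1))"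

lemma slope_add2: "slope (Suc (Suc n)) = 27 + slope n"
  by (simp add: slope_def)

text \<open>Consistency of the differential system: this compares the coefficients of
  \<open>t R_(n+1)\<close> when \<open>theta\<close> is applied to the recurrence of the
  remainders.\<close>

lemma coupling_Suc_Suc:
  "coupling (Suc (Suc n)) =
     coupling n + pivot n / pivot (Suc n) * (27 + slope n - slope (Suc n))"
proof (cases n)
  case 0
  then show ?thesis using pivot_quot_odd[of 0] by (simp add: coupling_def slope_def)
next
  case (Suc m)
  have "27 + slope n - slope (Suc n) = (if even n then 9 else 18)"
    by (auto simp: slope_def elim!: oddE)
  moreover have "coupling (Suc (Suc n)) = (4 * of_nat n + 6) * pivot_quot (Suc n) * pivot n / pivot (Suc n)"
    by (simp add: coupling_def)
  moreover have "coupling n = (4 * of_nat n - 2) * pivot_quot n * pivot n / pivot (Suc n)"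
    using Suc pivot_nonzero[of m] pivot_nonzero[of "Suc m"] pivot_quot_nonzero[of n]
    by (simp add: coupling_def)
  ultimately show ?thesis
    by (simp only: pivot_quot_rec) (simp add: algebra_simps add_divide_distrib diff_divide_distrib)
qed

section \<open>The remainders and their differential system\<close>

definition tpoly :: "rat poly" where
  "tpoly = [:0, 1:] * [:1, 1:]\<^sup>2"

fun remainder :: "nat \<Rightarrow> rat poly" where
  "remainder 0 = 1"
| "remainder (Suc 0) = [:0, 1:] * [:1, 1:]"
| "remainder (Suc (Suc n)) =
     tpoly * remainder n - smult (pivot n / pivot (Suc n)) (remainder (Suc n))"

text \<open>Up to the factor \<open>1 + 3 x\<close>, this is the derivation \<open>t (4 + 27 t) d/dt\<close> applied to
  \<open>r / (1 + 3 x)\<close>; note that \<open>dt/dx = (1 + x) (1 + 3 x)\<close> and \<open>4 + 27 t = (1 + 3 x)\<^sup>2 (4 + 3 x)\<close>.\<close>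

definition theta :: "rat poly \<Rightarrow> rat poly" where
  "theta r = [:0, 1:] * [:1, 1:] * [:4, 3:] * ([:1, 3:] * pderiv r - smult 3 r)"

lemma rat_poly_eqI: "(\<And>x. poly p x = poly q x) \<Longrightarrow> p = (q :: rat poly)"
  using poly_eq_poly_eq_iff by blast

lemma theta_diff: "theta (r - s) = theta r - theta s"
  by (rule rat_poly_eqI) (simp add: theta_def pderiv_diff algebra_simps
      del: mult_pCons_left mult_pCons_right)

lemma theta_smult: "theta (smult a r) = smult a (theta r)"
  by (rule rat_poly_eqI) (simp add: theta_def pderiv_smult algebra_simps
      del: mult_pCons_left mult_pCons_right)

lemma pderiv_tpoly: "pderiv tpoly = [:1, 1:] * [:1, 3:]"
  by (simp add: tpoly_def power2_eq_square pderiv_pCons)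

text \<open>Leibniz rule for a derivation that maps \<open>t\<close> to
  \<open>t (4 + 27 t)\<close>.\<close>

lemma theta_tpoly_mult: "theta (tpoly * r) = tpoly * theta r + ([:4:] + 27 * tpoly) * (tpoly * r)"
proof (rule rat_poly_eqI)
  fix x
  have "poly tpoly x = x * (1 + x)\<^sup>2" "poly (pderiv tpoly) x = (1 + x) * (1 + 3 * x)"
    unfolding pderiv_tpoly by (simp_all add: tpoly_def algebra_simps)
  then show "poly (theta (tpoly * r)) x =
      poly (tpoly * theta r + ([:4:] + 27 * tpoly) * (tpoly * r)) x"
    unfolding theta_def pderiv_mult
    by (simp add: numeral_poly algebra_simps power2_eq_square del: mult_pCons_left mult_pCons_right)
qed

text \<open>Both identities are carried along together. The second for \<open>Suc n\<close> follows
  from the first for \<open>n\<close> by eliminating \<open>t R_n\<close> through the recurrence;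
  the first for \<open>Suc n\<close> follows by applying \<open>theta\<close> to the
  recurrence.\<close>

lemma theta_remainder:
  "theta (remainder (Suc n)) =
     ([:2:] + smult (slope (Suc n)) tpoly) * remainder (Suc n) +
     smult (coupling (Suc n)) (tpoly * remainder n) \<and>
   theta (remainder n) =
     ([:4 * of_nat n:] + smult (slope n) tpoly) * remainder n +
     smult (coupling n) (remainder (Suc n))"
proof (induction n)
  case 0
  show ?case
    by (simp add: theta_def tpoly_def coupling_def slope_def pderiv_pCons power2_eq_square)
next
  case (Suc n)
  define L where "L = pivot n / pivot (Suc n)"
  define C where "C = coupling (Suc n)"
  \<comment> \<open>This value turns the constant 2 of the first identity into the
    \<open>4 (n + 1)\<close> of the second.\<close>
  have LC: "L * C = 4 * of_nat n + 2"
    using pivot_nonzero[of n] pivot_nonzero[of "Suc n"] by (simp add: L_def C_def coupling_def)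
  have coup: "coupling (Suc (Suc n)) = coupling n + L * (27 + slope n - slope (Suc n))"
    unfolding L_def by (rule coupling_Suc_Suc)
  have rem: "remainder (Suc (Suc n)) = tpoly * remainder n - smult L (remainder (Suc n))"
    by (simp add: L_def)
  have second: "theta (remainder (Suc n)) =
     ([:4 * of_nat (Suc n):] + smult (slope (Suc n)) tpoly) * remainder (Suc n) +
     smult (coupling (Suc n)) (remainder (Suc (Suc n)))"
  proof (rule rat_poly_eqI)
    fix x
    have "poly (theta (remainder (Suc n))) x = (2 + slope (Suc n) * poly tpoly x) * poly (remainder (Suc n)) x
       + C * (poly tpoly x * poly (remainder n) x)"
      using Suc by (simp add: C_def)
    moreover have "poly (remainder (Suc (Suc n))) x =
        poly tpoly x * poly (remainder n) x - L * poly (remainder (Suc n)) x"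
      by (simp only: rem poly_diff poly_mult poly_smult)
    ultimately have "poly (theta (remainder (Suc n))) x =
       (2 + L * C + slope (Suc n) * poly tpoly x) * poly (remainder (Suc n)) x
       + C * poly (remainder (Suc (Suc n))) x"
      by (simp only:) (simp add: algebra_simps)
    then show "poly (theta (remainder (Suc n))) x =
       poly (([:4 * of_nat (Suc n):] + smult (slope (Suc n)) tpoly) * remainder (Suc n) +
         smult (coupling (Suc n)) (remainder (Suc (Suc n)))) x"
      unfolding LC by (simp add: C_def del: remainder.simps)
  qed
  have "theta (remainder (Suc (Suc n))) =
     ([:2:] + smult (slope (Suc (Suc n))) tpoly) * remainder (Suc (Suc n)) +
     smult (coupling (Suc (Suc n))) (tpoly * remainder (Suc n))"
  proof (rule rat_poly_eqI)
    fix x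
    define t r0 r1 r2 q0 q1 where defs: "t = poly tpoly x" "r0 = poly (remainder n) x"
      "r1 = poly (remainder (Suc n)) x" "r2 = poly (remainder (Suc (Suc n))) x"
      "q0 = poly (theta (remainder n)) x" "q1 = poly (theta (remainder (Suc n))) x"
    have q2: "poly (theta (remainder (Suc (Suc n)))) x = t * q0 + (4 + 27 * t) * (t * r0) - L * q1"
      unfolding rem theta_diff theta_smult theta_tpoly_mult by (simp add: defs numeral_poly)
    have r2: "r2 = t * r0 - L * r1"
      by (simp only: defs rem poly_diff poly_mult poly_smult)
    have LC': "4 * rat_of_nat n = L * C - 2" using LC by simp
    have q1: "q1 = (2 + slope (Suc n) * t) * r1 + C * (t * r0)"
      and q0: "q0 = (4 * of_nat n + slope n * t) * r0 + coupling n * r1"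
      using Suc by (simp_all add: defs C_def)
    have "poly (theta (remainder (Suc (Suc n)))) x =
      (2 + (27 + slope n) * t) * r2 + (coupling n + L * (27 + slope n - slope (Suc n))) * (t * r1)"
      unfolding q2 q1 q0 r2 LC' by (simp add: algebra_simps)
    then show "poly (theta (remainder (Suc (Suc n)))) x =
      poly (([:2:] + smult (slope (Suc (Suc n))) tpoly) * remainder (Suc (Suc n)) +
       smult (coupling (Suc (Suc n))) (tpoly * remainder (Suc n))) x"
      by (simp only: coup slope_add2 defs poly_add poly_mult poly_smult poly_pCons poly_0 mult_zero_right add_0_right)
  qed
  with second show ?case by blast
qed

text \<open>The recurrence cancels the lowest coefficients, so the order in \<open>x\<close> grows
  by one. The new lowest coefficient is then found by comparing lowest terms in the first identity
  of \<open>theta_remainder\<close>.\<close>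

lemma remainder_leading:
  "\<exists>r. remainder n = [:0, 1:] ^ n * r \<and> poly r 0 = pivot n"
proof (induction n rule: remainder.induct)
  case 1
  show ?case by (intro exI[of _ 1]) simp
next
  case 2
  show ?case by (intro exI[of _ "[:1, 1:]"]) simp
next
  case (3 n)
  define X where "X = ([:0, 1:] :: rat poly)"
  obtain r where r: "remainder n = X ^ n * r" "poly r 0 = pivot n" using 3 X_def by blast
  obtain s where s: "remainder (Suc n) = X ^ Suc n * s" "poly s 0 = pivot (Suc n)"
    using 3 X_def by blast
  have tX: "tpoly = X * [:1, 1:]\<^sup>2" by (simp only: tpoly_def X_def)
  define u where "u = [:1, 1:]\<^sup>2 * r - smult (pivot n / pivot (Suc n)) s"
  have "remainder (Suc (Suc n)) = X ^ Suc n * u"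
    unfolding remainder.simps r s u_def tX
    by (simp only: right_diff_distrib power_Suc mult_smult_right mult.assoc mult.left_commute)
  \<comment> \<open>The constant terms cancel:
    \<open>p_n - (p_n / p_(n+1)) p_(n+1) = 0\<close>.\<close>
  moreover have "poly u 0 = 0"
    using r s pivot_nonzero[of "Suc n"] by (simp add: u_def)
  then obtain v where "u = X * v" unfolding X_def by (metis dvdE minus_zero poly_eq_0_iff_dvd)
  ultimately have v: "remainder (Suc (Suc n)) = X ^ Suc (Suc n) * v"
    by (simp only: power_Suc2 mult.assoc)
  have pd: "pderiv (X ^ Suc (Suc n)) = smult (of_nat n + 2) (X ^ Suc n)"
    unfolding pderiv_power_Suc by (simp add: X_def pderiv_pCons algebra_simps)
  \<comment> \<open>The cofactor of \<open>theta (remainder (Suc (Suc n)))\<close>: the factor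
    \<open>x\<close> in \<open>theta\<close> restores the power lost by differentiation.\<close>
  define w where "w = [:1, 1:] * [:4, 3:] *
    ([:1, 3:] * (smult (of_nat n + 2) v + X * pderiv v) - smult 3 (X * v))"
  have "theta (remainder (Suc (Suc n))) = X ^ Suc (Suc n) * w"
  proof (rule rat_poly_eqI)
    fix x
    show "poly (theta (remainder (Suc (Suc n)))) x = poly (X ^ Suc (Suc n) * w) x"
      unfolding v theta_def w_def pderiv_mult pd
      by (simp add: X_def algebra_simps del: mult_pCons_left mult_pCons_right)
  qed
  moreover have "theta (remainder (Suc (Suc n))) = X ^ Suc (Suc n) *
     (([:2:] + smult (slope (Suc (Suc n))) tpoly) * v +
     smult (coupling (Suc (Suc n))) ([:1, 1:]\<^sup>2 * s))"
    unfolding conjunct1[OF theta_remainder[of "Suc n"]] unfolding v s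
    by (rule rat_poly_eqI)
      (simp add: tX algebra_simps del: mult_pCons_left mult_pCons_right)
  moreover have "X ^ Suc (Suc n) \<noteq> 0" by (simp add: X_def)
  ultimately have "w = ([:2:] + smult (slope (Suc (Suc n))) tpoly) * v +
      smult (coupling (Suc (Suc n))) ([:1, 1:]\<^sup>2 * s)"
    by (metis mult_left_cancel)
  from arg_cong[OF this, of "\<lambda>q. poly q 0"]
  have "4 * (of_nat n + 2) * poly v 0 = 2 * poly v 0 + coupling (Suc (Suc n)) * pivot (Suc n)"
    using s(2) by (simp add: tpoly_def w_def X_def algebra_simps)
  moreover have "coupling (Suc (Suc n)) * pivot (Suc n) = (4 * of_nat n + 6) * pivot (Suc (Suc n))"
    using pivot_nonzero[of "Suc n"] by (simp add: coupling_def)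
  ultimately have "(4 * of_nat n + 6) * poly v 0 = (4 * of_nat n + 6) * pivot (Suc (Suc n))"
    by (simp add: algebra_simps)
  moreover have "4 * rat_of_nat n + 6 > 0" by (intro add_nonneg_pos; simp)
  ultimately have "poly v 0 = pivot (Suc (Suc n))" by simp
  with v show ?case unfolding X_def by blast
qed

section \<open>Row reduction of the binomial matrix\<close>

definition row_poly :: "nat \<Rightarrow> rat poly" where
  "row_poly i = [:0, 1:] ^ ((i + 1) div 2) * [:1, 1:] ^ i"

text \<open>The row operations that turn the rows \<open>row_poly\<close> into the remainders.\<close>

fun reduction :: "nat \<Rightarrow> nat \<Rightarrow> rat" where
  "reduction 0 i = (if i = 0 then 1 else 0)"
| "reduction (Suc 0) i = (if i = 1 then 1 else 0)"
| "reduction (Suc (Suc n)) i = (if i \<ge> 2 then reduction n (i - 2) else 0) -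
     pivot n / pivot (Suc n) * reduction (Suc n) i"

lemma reduction_upper: "n < i \<Longrightarrow> reduction n i = 0"
  by (induction n i rule: reduction.induct) auto

lemma reduction_diag: "reduction n n = 1"
  by (induction n rule: pivot.induct) (auto simp: reduction_upper)

lemma row_poly_add2: "row_poly (Suc (Suc i)) = tpoly * row_poly i"
  unfolding row_poly_def tpoly_def
  by (simp only: power_add[of _ _ "2::nat", symmetric] flip: add_2_eq_Suc') 
     (simp add: power_add power2_eq_square algebra_simps del: mult_pCons_left mult_pCons_right)

lemma smult_sum_right: "smult a (sum f S) = (\<Sum>i\<in>S. smult a (f i))"
  by (induction S rule: infinite_finite_induct) (simp_all add: smult_add_right)

text \<open>Multiplication by \<open>tpoly\<close> shifts the rows by two places, so both sides obey
  the same recurrence. The free bound \<open>N\<close> allows a shorter sum for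
  \<open>remainder n\<close>.\<close>

lemma remainder_expand: "n < N \<Longrightarrow> remainder n = (\<Sum>i<N. smult (reduction n i) (row_poly i))"
proof (induction n arbitrary: N rule: remainder.induct)
  case 1
  then obtain M where "N = Suc M" by (cases N) auto
  then show ?case by (simp add: sum.lessThan_Suc_shift row_poly_def del: sum.lessThan_Suc)
next
  case 2
  then obtain M where "N = Suc (Suc M)" by (metis Suc_lessD less_imp_Suc_add add.left_neutral plus_nat.simps(2))
  then show ?case by (simp add: sum.lessThan_Suc_shift row_poly_def one_pCons del: sum.lessThan_Suc)
next
  case (3 n)
  then obtain M where M: "N = Suc (Suc M)" "n < M"
    by (metis Suc_less_eq2)
  have "(\<Sum>i<N. smult (if i \<ge> 2 then reduction n (i - 2) else 0) (row_poly i)) =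
        (\<Sum>i<M. smult (reduction n i) (tpoly * row_poly i))"
    unfolding M by (simp add: sum.lessThan_Suc_shift row_poly_add2 del: sum.lessThan_Suc)
  also have "\<dots> = tpoly * remainder n"
    unfolding 3(1)[OF M(2)] by (simp add: sum_distrib_left)
  finally show ?case
    using 3(2)[of N] 3(3)
    by (simp add: smult_diff_left sum_subtractf smult_sum_right)
qed

lemma coeff_remainder:
  "coeff (remainder n) n = pivot n" "c < n \<Longrightarrow> coeff (remainder n) c = 0"
proof -
  obtain r where r: "remainder n = [:0, 1:] ^ n * r" "poly r 0 = pivot n"
    using remainder_leading by blast
  have "[:0, 1:] ^ n = (monom 1 n :: rat poly)"
    by (simp add: monom_altdef)
  with r show "coeff (remainder n) n = pivot n" "c < n \<Longrightarrow> coeff (remainder n) c = 0"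
    by (simp_all add: coeff_monom_mult poly_0_coeff_0)
qed

lemma coeff_row_poly:
  "coeff (row_poly i) c = (if (i + 1) div 2 \<le> c then of_nat (i choose (c - (i + 1) div 2)) else 0)"
proof -
  have "[:0, 1:] ^ m = (monom 1 m :: rat poly)" for m
    by (simp add: monom_altdef)
  moreover have "coeff ([:1, 1:] ^ i) m = rat_of_nat (i choose m)" for m
    by (induction i arbitrary: m) (auto simp: coeff_pCons split: nat.split)
  ultimately show ?thesis
    by (simp add: row_poly_def coeff_monom_mult)
qed

text \<open>Vandermonde convolution; the coefficients of \<open>row_poly i\<close> are the binomials
  of \<open>i\<close>, shifted by its power of \<open>x\<close>.\<close>

lemma binomial_matrix_factor:
  assumes "i < n"
  shows "rat_of_nat ((i + j) choose (n - 1 - (i + 1) div 2)) =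
    (\<Sum>l<n. coeff (row_poly i) (n - 1 - l) * of_nat (j choose l))"
proof -
  define c where "c = n - 1 - (i + 1) div 2"
  have "(i + j) choose c = (\<Sum>l\<le>c. (j choose l) * (i choose (c - l)))"
    using vandermonde[of j i c] by (simp add: add.commute)
  then have "rat_of_nat ((i + j) choose c) = (\<Sum>l\<le>c. of_nat (j choose l) * of_nat (i choose (c - l)))"
    by (simp only: of_nat_sum of_nat_mult)
  also have "\<dots> = (\<Sum>l<n. coeff (row_poly i) (n - 1 - l) * of_nat (j choose l))"
  proof (rule sum.mono_neutral_cong_left)
    show "{..c} \<subseteq> {..<n}" using assms by (auto simp: c_def)
    \<comment> \<open>Here \<open>n - 1 - l\<close> lies below the order of
      \<open>row_poly i\<close> at 0.\<close>
    show "\<forall>l\<in>{..<n} - {..c}. coeff (row_poly i) (n - 1 - l) * of_nat (j choose l) = 0"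
      using assms by (auto simp: c_def coeff_row_poly)
    show "of_nat (j choose l) * of_nat (i choose (c - l)) =
        coeff (row_poly i) (n - 1 - l) * of_nat (j choose l)" if "l \<in> {..c}" for l
    proof -
      have "n - 1 - l - (i + 1) div 2 = c - l" "(i + 1) div 2 \<le> n - 1 - l"
        using that assms by (auto simp: c_def)
      then show ?thesis by (simp add: coeff_row_poly)
    qed
  qed simp
  finally show ?thesis by (simp only: c_def)
qed

text \<open>\<open>M = A * U\<close> and \<open>R = L * A\<close> with unitriangular
  \<open>U\<close> and \<open>L\<close>, so \<open>M\<close> and \<open>R\<close> have the same
  determinant; \<open>R\<close> is lower triangular with the pivots on its diagonal. Rows and
  coefficients are listed in reverse to fit the flagged matrix.\<close>

lemma det_binomial:
  "det (mat n n (\<lambda>(r, j). rat_of_nat ((n - 1 - r + j) choose (n - 1 - (n - r) div 2)))) =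
   (\<Prod>m<n. pivot m)"
proof -
  define M where "M = mat n n (\<lambda>(r, j). rat_of_nat ((n - 1 - r + j) choose (n - 1 - (n - r) div 2)))"
  define L where "L = mat n n (\<lambda>(r, s). reduction (n - 1 - r) (n - 1 - s))"
  define A where "A = mat n n (\<lambda>(r, l). coeff (row_poly (n - 1 - r)) (n - 1 - l))"
  define R where "R = mat n n (\<lambda>(r, l). coeff (remainder (n - 1 - r)) (n - 1 - l))"
  define U where "U = mat n n (\<lambda>(l, j). rat_of_nat (j choose l))"
  have car: "M \<in> carrier_mat n n" "L \<in> carrier_mat n n" "A \<in> carrier_mat n n"
    "R \<in> carrier_mat n n" "U \<in> carrier_mat n n"
    by (simp_all add: M_def L_def A_def R_def U_def)
  have "M = A * U"
  proof (rule eq_matI)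
    fix r j assume "r < dim_row (A * U)" "j < dim_col (A * U)"
    then have rj: "r < n" "j < n" using car by auto
    then have "n - 1 - r + 1 = n - r" by simp
    then show "M $$ (r, j) = (A * U) $$ (r, j)"
      using rj binomial_matrix_factor[of "n - 1 - r" n j]
      by (simp add: M_def A_def U_def scalar_prod_def lessThan_atLeast0)
  qed (use car in auto)
  then have "det M = det A * det U"
    using car det_mult by blast
  moreover have "R = L * A"
  proof (rule eq_matI)
    fix r l assume "r < dim_row (L * A)" "l < dim_col (L * A)"
    then have rl: "r < n" "l < n" using car by auto
    have "coeff (remainder (n - 1 - r)) (n - 1 - l) =
      (\<Sum>s<n. reduction (n - 1 - r) s * coeff (row_poly s) (n - 1 - l))"
      using rl by (subst remainder_expand[of "n - 1 - r" n]) (simp_all add: coeff_sum)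
    also have "\<dots> = (\<Sum>s<n. reduction (n - 1 - r) (n - 1 - s) * coeff (row_poly (n - 1 - s)) (n - 1 - l))"
      by (subst sum.nat_diff_reindex[symmetric]) simp
    finally show "R $$ (r, l) = (L * A) $$ (r, l)"
      using rl by (simp add: R_def L_def A_def scalar_prod_def lessThan_atLeast0)
  qed (use car in auto)
  then have "det R = det L * det A"
    using car det_mult by blast
  moreover have "det U = 1"
    using det_upper_triangular[OF _ car(5)]
    by (auto simp: U_def upper_triangular_def prod_list_diag_prod)
  moreover have "det L = 1"
    using det_upper_triangular[OF _ car(2)]
    by (auto simp: L_def upper_triangular_def prod_list_diag_prod reduction_upper reduction_diag)
  moreover have "det R = (\<Prod>m<n. pivot m)"
  proof -
    have "det R = (\<Prod>r<n. pivot (n - 1 - r))"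
      using det_lower_triangular[OF _ car(4)]
      by (auto simp: R_def prod_list_diag_prod coeff_remainder lessThan_atLeast0)
    also have "\<dots> = (\<Prod>m<n. pivot m)"
      by (subst prod.nat_diff_reindex[symmetric]) simp
    finally show ?thesis .
  qed
  ultimately show ?thesis by (simp add: M_def)
qed

section \<open>Products of pivots and the two product formulas\<close>

lemma pivot_pair_even:
  "pivot (2 * k) * pivot (2 * k + 1) =
     of_nat (3*k + 1) * fact (6*k) * fact (2*k) / (fact (4*k + 1) * fact (4*k))"
proof (induction k)
  case 0
  show ?case by simp
next
  case (Suc k)
  define a where "a = rat_of_nat k"
  define A B C where "A = (fact (6*k) :: rat)" and "B = (fact (2*k) :: rat)" and "C = (fact (4*k) :: rat)"
  have nn: "a \<ge> 0" and pos: "C \<noteq> 0" by (simp_all add: a_def C_def)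
  then have nz: "3*a+1 \<noteq> 0" "4*a+1 \<noteq> 0" "4*a+3 \<noteq> 0" "4*a+5 \<noteq> 0"
    by simp_all
  have facts: "fact (6 * Suc k) = (6*a+6)*(6*a+5)*(6*a+4)*(6*a+3)*(6*a+2)*(6*a+1)*A"
    "fact (2 * Suc k) = (2*a+2)*(2*a+1)*B"
    "fact (4 * Suc k) = (4*a+4)*(4*a+3)*(4*a+2)*(4*a+1)*C"
    "fact (4 * Suc k + 1) = (4*a+5)*((4*a+4)*(4*a+3)*(4*a+2)*(4*a+1)*C)"
    "fact (4 * k + 1) = (4*a+1)*C"
    by (simp_all add: a_def A_def B_def C_def fact_Suc algebra_simps numeral_eq_Suc)
  have g1: "pivot_quot (2 * k + 1) = 6 * (6 * a + 1) * (3 * a + 2) / ((8 * a + 6) * (8 * a + 2))"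
    using pivot_quot_odd[of k] by (simp add: a_def)
  have g2: "pivot_quot (2 * k + 2) = 6 * (6 * a + 5) * (3 * a + 4) / ((8 * a + 10) * (8 * a + 6))"
    using pivot_quot_even[of "Suc k"] by (simp add: a_def algebra_simps)
  \<comment> \<open>Successive pairs differ by a product of two values of \<open>pivot_quot\<close>,
    matched below with the growth of the factorials.\<close>
  have "pivot (2 * Suc k) * pivot (2 * Suc k + 1) =
     pivot_quot (2 * k + 1) * pivot_quot (2 * k + 2) * (pivot (2 * k) * pivot (2 * k + 1))"
    by simp
  also have "\<dots> = (6 * (6 * a + 1) * (3 * a + 2) / ((8 * a + 6) * (8 * a + 2))) *
       (6 * (6 * a + 5) * (3 * a + 4) / ((8 * a + 10) * (8 * a + 6))) *
       ((3*a + 1) * A * B / (((4*a+1)*C) * C))"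
    unfolding Suc g1 g2 facts by (simp add: A_def B_def C_def a_def)
  also have "\<dots> = (3 * a + 4) * ((6*a+6)*(6*a+5)*(6*a+4)*(6*a+3)*(6*a+2)*(6*a+1)*A) * ((2*a+2)*(2*a+1)*B) /
      ((4*a+5)*((4*a+4)*(4*a+3)*(4*a+2)*(4*a+1)*C) * ((4*a+4)*(4*a+3)*(4*a+2)*(4*a+1)*C))"
  proof -
    \<comment> \<open>Every linear factor is a multiple of one of these ten, which reduces the claim
      to a cancellation of monomials.\<close>
    define p q r u v w x y z b where
      defs: "p = a+1" "q = 2*a+1" "r = 3*a+1" "u = 4*a+1" "v = 4*a+3" "w = 4*a+5"
        "x = 6*a+1" "y = 3*a+2" "z = 6*a+5" "b = 3*a+4"
    have e: "8*a+6 = 2*v" "8*a+2 = 2*u" "8*a+10 = 2*w" "6*a+6 = 6*p" "6*a+4 = 2*y" "6*a+3 = 3*q"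
      "6*a+2 = 2*r" "4*a+4 = 4*p" "4*a+2 = 2*q" "2*a+2 = 2*p" "2*a+1 = q" "3*a+1 = r" "4*a+1 = u"
      "4*a+3 = v" "4*a+5 = w" "6*a+1 = x" "3*a+2 = y" "6*a+5 = z" "3*a+4 = b"
      by (simp_all add: defs)
    have "p \<noteq> 0" "q \<noteq> 0" using nn by (simp_all add: defs)
    then show ?thesis using nz pos unfolding e by (simp add: divide_simps)
  qed
  also have "\<dots> = of_nat (3*Suc k + 1) * fact (6*Suc k) * fact (2*Suc k) / (fact (4*Suc k + 1) * fact (4*Suc k))"
    unfolding facts by (simp add: a_def algebra_simps)
  finally show ?case .
qed

text \<open>Replacing \<open>pivot (2 * k)\<close> by \<open>pivot (2 * k + 2)\<close> multiplies
  the even pair by \<open>pivot_quot (2 * k + 1)\<close>.\<close>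

lemma pivot_pair_odd:
  "pivot (2 * k + 1) * pivot (2 * k + 2) =
     of_nat (3*k + 2) * fact (6*k + 3) * fact (2*k + 1) / (fact (4*k + 2) * fact (4*k + 3))"
proof -
  define a where "a = rat_of_nat k"
  define A B C where "A = (fact (6*k) :: rat)" and "B = (fact (2*k) :: rat)" and "C = (fact (4*k) :: rat)"
  have nn: "a \<ge> 0" and pos: "C \<noteq> 0" by (simp_all add: a_def C_def)
  have facts: "fact (6 * k + 3) = (6*a+3)*(6*a+2)*(6*a+1)*A"
    "fact (2 * k + 1) = (2*a+1)*B"
    "fact (4 * k + 2) = (4*a+2)*(4*a+1)*C"
    "fact (4 * k + 3) = (4*a+3)*(4*a+2)*(4*a+1)*C"
    "fact (4 * k + 1) = (4*a+1)*C"
    by (simp_all add: a_def A_def B_def C_def fact_Suc algebra_simps numeral_eq_Suc)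
  have g1: "pivot_quot (2 * k + 1) = 6 * (6 * a + 1) * (3 * a + 2) / ((8 * a + 6) * (8 * a + 2))"
    using pivot_quot_odd[of k] by (simp add: a_def)
  have "pivot (2 * k + 1) * pivot (2 * k + 2) = pivot_quot (2 * k + 1) * (pivot (2 * k) * pivot (2 * k + 1))"
    by simp
  also have "\<dots> = (6 * (6 * a + 1) * (3 * a + 2) / ((8 * a + 6) * (8 * a + 2))) *
       ((3*a + 1) * A * B / (((4*a+1)*C) * C))"
    unfolding pivot_pair_even g1 facts by (simp add: A_def B_def C_def a_def)
  also have "\<dots> = (3 * a + 2) * ((6*a+3)*(6*a+2)*(6*a+1)*A) * ((2*a+1)*B) /
      ((4*a+2)*(4*a+1)*C * ((4*a+3)*(4*a+2)*(4*a+1)*C))"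
  proof -
    have e: "8*a+6 = 2*(4*a+3)" "8*a+2=2*(4*a+1)"
      "6*a+3=3*(2*a+1)" "6*a+2=2*(3*a+1)" "4*a+2=2*(2*a+1)" by simp_all
    have "2*a+1 \<noteq> 0" "3*a+1 \<noteq> 0" "4*a+1 \<noteq> 0" "4*a+3 \<noteq> 0" using nn by simp_all
    then show ?thesis using pos unfolding e by (simp add: divide_simps) (simp add: algebra_simps)
  qed
  finally show ?thesis unfolding facts by (simp add: a_def)
qed

text \<open>Grouped in pairs \<open>(2 j, 2 j + 1)\<close>, the pivots give the factors of
  \<open>CSTCPP\<close>; the pair for \<open>j = 0\<close> is 1.\<close>

lemma prod_pivot_even: "k \<ge> 1 \<Longrightarrow> (\<Prod>m<2*k. pivot m) = CSTCPP k"
proof (induction k rule: nat_induct_at_least)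
  case base
  show ?case by (simp add: CSTCPP_def numeral_2_eq_2)
next
  case (Suc k)
  have "(\<Prod>m<2 * Suc k. pivot m) = (\<Prod>m<2*k. pivot m) * (pivot (2 * k) * pivot (2 * k + 1))"
    by (simp add: mult.assoc)
  then show ?case
    unfolding pivot_pair_even Suc using Suc(1) by (simp add: CSTCPP_def)
qed

lemma prod_pivot_odd: "k \<ge> 1 \<Longrightarrow> (\<Prod>m<2*k+1. pivot m) = VSASM k"
proof (induction k rule: nat_induct_at_least)
  case base
  \<comment> \<open>Here the pairs are \<open>(2 j + 1, 2 j + 2)\<close>; the first three pivots all
    equal 1.\<close>
  show ?case using pivot_quot_odd[of 0] by (simp add: VSASM_def numeral_2_eq_2)
next
  case (Suc k)
  have "(\<Prod>m<2 * Suc k + 1. pivot m) = (\<Prod>m<2*k+1. pivot m) * (pivot (2 * k + 1) * pivot (2 * k + 2))"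
    by (simp add: mult.assoc)
  then show ?case
    unfolding pivot_pair_odd Suc using Suc(1) by (simp add: VSASM_def)
qed

lemma subst_schubert_unimodal:
  "subst (\<lambda>_. 1) (schubert n (one_line (unimodal_word n))) = (\<Prod>m<n. pivot m)"
proof -
  have "map_mat (subst (\<lambda>_. 1)) (flag_mat n (final_flag n)) =
     mat n n (\<lambda>(r, j). rat_of_nat ((n - 1 - r + j) choose (n - 1 - (n - r) div 2)))"
  proof (rule eq_matI)
    fix r j assume "r < dim_row (mat n n (\<lambda>(r, j). rat_of_nat ((n - 1 - r + j) choose (n - 1 - (n - r) div 2))))"
      "j < dim_col (mat n n (\<lambda>(r, j). rat_of_nat ((n - 1 - r + j) choose (n - 1 - (n - r) div 2))))"
    then have rj: "r < n" "j < n" by auto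
    define p where "p = n - 1 - (n - r) div 2"
    \<comment> \<open>This holds because
      \<open>(n - 1 - r) div 2 + (n - r) div 2 = n - 1 - r\<close>; thus the entry has
      \<open>p + 1\<close> variables, as \<open>subst_hom_sym\<close> expects.\<close>
    have p: "final_flag n r = Suc p"
      using rj by (simp add: final_flag_def p_def)
    have "int n - int r - int (Suc p) + int j = int (n - 1 - r + j) - int p"
      using rj by simp
    then have entry: "flag_mat n (final_flag n) $$ (r, j) = hom_sym {1..Suc p} (int (n - 1 - r + j) - int p)"
      unfolding flag_mat_def using rj by (simp only: index_mat prod.case p)
    have "map_mat (subst (\<lambda>_. 1)) (flag_mat n (final_flag n)) $$ (r, j) =
        subst (\<lambda>_. 1) (flag_mat n (final_flag n) $$ (r, j))"
      using rj flag_mat_carrier[of n "final_flag n"] by simp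
    also have "\<dots> = rat_of_nat ((n - 1 - r + j) choose p)"
      unfolding entry by (rule subst_hom_sym) auto
    finally show "map_mat (subst (\<lambda>_. 1)) (flag_mat n (final_flag n)) $$ (r, j) =
       mat n n (\<lambda>(r, j). rat_of_nat ((n - 1 - r + j) choose (n - 1 - (n - r) div 2))) $$ (r, j)"
      using rj by (simp add: p_def)
  qed (simp_all add: flag_mat_def)
  then show ?thesis
    using det_binomial[of n] by (simp add: schubert_unimodal subst_det[OF flag_mat_carrier])
qed

theorem proposition5p7:
  fixes k :: nat
  assumes "k \<ge> 1"
  shows "subst (\<lambda>_. 1) (schubert (2 * k) (w_minus k)) = CSTCPP k
       \<and> subst (\<lambda>_. 1) (schubert (2 * k + 1) (w_plus k)) = VSASM k"
  unfolding w_minus_def w_plus_def unimodal_word_eq[THEN conjunct1, symmetric]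
    unimodal_word_eq[THEN conjunct2, symmetric] subst_schubert_unimodal
    prod_pivot_even[OF assms] prod_pivot_odd[OF assms]
  by simp

end
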